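(* Let $L$ be an $\mathbb{R}^d$-valued Lévy basis on $\mathbb{R}^m$ with characteristics $(\gamma,\Sigma,\nu)$ such that $\int_{\|x\|>1}\|x\|^2\nu(dx)<\infty$ and $\gamma+\int_{\|x\|>1}x\,\nu(dx)=0$. Let $g:\mathbb{R}^m\to M_{n\times d}(\mathbb{R})$ be measurable and exponentially bounded in norm, i.e. there exist constants $M,K>0$ such that $$\|g(t)\|^2\le Me^{-K\|t\|}\qquad\text{for all }t\in\mathbb{R}^m.$$ Then the moving average field $X_t=\int_{\mathbb{R}^m}g(t-s)\,L(ds)$, $t\in\mathbb{R}^m$, is $\eta$-weakly dependent with exponentially decaying $\eta$-coefficients, i.e. there are constants $C,\kappa>0$ with $\eta_X(h)\le Ce^{-\kappa h}$ for all $h>0$.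
   Context: An $\mathbb{R}^d$-valued Lévy basis on $\mathbb{R}^m$ with characteristics $(\gamma,\Sigma,\nu)$ is a family $L=\{L(B)\}$ of $\mathbb{R}^d$-valued random variables indexed by the bounded Borel sets $B\subset\mathbb{R}^m$, with independent values on disjoint sets, almost surely $\sigma$-additive, and with $E[e^{i\langle u,L(B)\rangle}]=e^{\Phi(u)\lambda(B)}$, $\lambda$ Lebesgue measure, where $\Phi(u)=i\langle\gamma,u\rangle-\frac12\langle u,\Sigma u\rangle+\int_{\mathbb{R}^d}(e^{i\langle u,x\rangle}-1-i\langle u,x\rangle\mathbb{1}_{[0,1]}(\|x\|))\nu(dx)$, $\gamma\in\mathbb{R}^d$, $\Sigma$ symmetric positive semidefinite, $\nu$ a Lévy measure. Stochastic integrals are in the sense of Rajput and Rosiński (1989). The norms may be any fixed norms (all are equivalent). $\eta$-weak dependence of an $\mathbb{R}^n$-valued field $X=(X_t)_{t\in\mathbb{R}^m}$: let $\mathcal{G}_u$ be the bounded functions $F:(\mathbb{R}^n)^u\to\mathbb{R}$ that are Lipschitz with respect to $\sum_{i=1}^u\|x_i-y_i\|$, with Lipschitz constant $Lip(F)$. $X$ is $\eta$-weakly dependent if $\eta_X(h)=\sup_{u,v\in\mathbb{N}}\eta_{u,v}(h)\to0$ as $h\to\infty$, where $\eta_{u,v}(h)$ is the supremum of $$\frac{|Cov(F(X_\Gamma),G(X_{\tilde\Gamma}))|}{u\|G\|_\infty Lip(F)+v\|F\|_\infty Lip(G)}$$ over $F\in\mathcal{G}_u$, $G\in\mathcal{G}_v$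 (non-zero denominator) and $\Gamma,\tilde\Gamma\subset\mathbb{R}^m$ with $|\Gamma|=u$, $|\tilde\Gamma|=v$ and $\inf_{i\in\Gamma,j\in\tilde\Gamma}\|i-j\|_\infty\ge h$; $X_\Gamma=(X_{i_1},\dots,X_{i_u})$ for $\Gamma=(i_1,\dots,i_u)$. *)

theory Defs
  imports "HOL-Probability.Probability"
begin

section \<open>Levy bases\<close>

definition levy_measure :: "(real ^ 'd) measure \<Rightarrow> bool" where
  "levy_measure \<nu> \<longleftrightarrow>
     sets \<nu> = sets borel \<and> emeasure \<nu> {0} = 0 \<and>
     (\<integral>\<^sup>+ x. ennreal (min 1 ((norm x)\<^sup>2)) \<partial>\<nu>) < \<infinity>"

definition levy_exponent ::
  "real ^ 'd \<Rightarrow> real ^ 'd ^ 'd \<Rightarrow> (real ^ 'd) measure \<Rightarrow> real ^ 'd \<Rightarrow> complex" where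
  "levy_exponent \<gamma> \<Sigma> \<nu> u =
     \<i> * of_real (\<gamma> \<bullet> u) - of_real (u \<bullet> (\<Sigma> *v u)) / 2 +
     (LINT x|\<nu>. exp (\<i> * of_real (u \<bullet> x)) - 1
                 - \<i> * of_real (u \<bullet> x) * of_real (indicator {0..1} (norm x)))"

abbreviation bounded_borel :: "(real ^ 'm) set \<Rightarrow> bool" where
  "bounded_borel B \<equiv> B \<in> sets borel \<and> bounded B"

text \<open>
  The map \<open>L\<close> is total, but its values outside the bounded Borel sets are unconstrained and
  never used. Independence is stated for sequences of disjoint sets; finite families are covered
  by padding with the empty set.
\<close>

locale levy_basis = prob_space P
  for P :: "'w measure"
    and L :: "(real ^ 'm) set \<Rightarrow> 'w \<Rightarrow> real ^ 'd"
    and \<gamma> :: "real ^ 'd"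
    and \<Sigma> :: "real ^ 'd ^ 'd"
    and \<nu> :: "(real ^ 'd) measure" +
  assumes Sigma_symmetric: "transpose \<Sigma> = \<Sigma>"
    and Sigma_psd: "\<And>u. 0 \<le> u \<bullet> (\<Sigma> *v u)"
    and levy_measure: "levy_measure \<nu>"
    and random_variable: "\<And>B. bounded_borel B \<Longrightarrow> L B \<in> borel_measurable P"
    and independent:
      "\<And>B :: nat \<Rightarrow> (real ^ 'm) set.
         disjoint_family B \<Longrightarrow> (\<And>i. bounded_borel (B i)) \<Longrightarrow>
         indep_vars (\<lambda>_. borel) (\<lambda>i. L (B i)) UNIV"
    and sigma_additive:
      "\<And>B :: nat \<Rightarrow> (real ^ 'm) set.
         disjoint_family B \<Longrightarrow> (\<And>i. bounded_borel (B i)) \<Longrightarrow> bounded (\<Union>i. B i) \<Longrightarrow>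
         AE \<omega> in P. (\<lambda>i. L (B i) \<omega>) sums L (\<Union>i. B i) \<omega>"
    and char_fun:
      "\<And>B u. bounded_borel B \<Longrightarrow>
         (LINT \<omega>|P. exp (\<i> * of_real (u \<bullet> L B \<omega>)))
           = exp (levy_exponent \<gamma> \<Sigma> \<nu> u * of_real (measure lborel B))"

section \<open>Stochastic integrals in the sense of Rajput and Rosinski\<close>

definition tendsto_in_prob ::
  "'w measure \<Rightarrow> (nat \<Rightarrow> 'w \<Rightarrow> real ^ 'n) \<Rightarrow> ('w \<Rightarrow> real ^ 'n) \<Rightarrow> bool" where
  "tendsto_in_prob P Y Z \<longleftrightarrow>
     (\<forall>k. Y k \<in> borel_measurable P) \<and> Z \<in> borel_measurable P \<and>
     (\<forall>\<epsilon>>0. (\<lambda>k. measure P {\<omega> \<in> space P. norm (Y k \<omega> - Z \<omega>) > \<epsilon>}) \<longlonglongrightarrow> 0)"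

text \<open>
  Simple integrands are the finite sums of matrices times indicators of disjoint bounded Borel
  sets. Below, such a function is integrated through its canonical representation over its level
  sets; the level set of 0 need not be bounded and is left out.
\<close>

definition levy_simple :: "(real ^ 'm \<Rightarrow> real ^ 'd ^ 'n) \<Rightarrow> bool" where
  "levy_simple f \<longleftrightarrow> simple_function borel f \<and> bounded {s. f s \<noteq> 0}"

definition simple_levy_integral ::
  "((real ^ 'm) set \<Rightarrow> 'w \<Rightarrow> real ^ 'd) \<Rightarrow> (real ^ 'm \<Rightarrow> real ^ 'd ^ 'n) \<Rightarrow> (real ^ 'm) set
     \<Rightarrow> 'w \<Rightarrow> real ^ 'n" where
  "simple_levy_integral L f A \<omega> = (\<Sum>y \<in> range f - {0}. y *v L (A \<inter> f -` {y}) \<omega>)"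

text \<open>
  The integral is determined only up to almost sure equality, hence a relation:
  \<open>has_levy_integral P L f A Y\<close> says that \<open>f\<close> is integrable and that \<open>Y\<close> is a version of its
  integral over \<open>A\<close>. As in the original definition, the integrals of the approximating simple
  functions must converge in probability over every Borel set \<open>B\<close>, not only over \<open>A\<close>.
\<close>

definition has_levy_integral ::
  "'w measure \<Rightarrow> ((real ^ 'm) set \<Rightarrow> 'w \<Rightarrow> real ^ 'd) \<Rightarrow> (real ^ 'm \<Rightarrow> real ^ 'd ^ 'n)
     \<Rightarrow> (real ^ 'm) set \<Rightarrow> ('w \<Rightarrow> real ^ 'n) \<Rightarrow> bool" where
  "has_levy_integral P L f A Y \<longleftrightarrow>
     f \<in> borel_measurable borel \<and> A \<in> sets borel \<and>
     (\<exists>F. (\<forall>k. levy_simple (F k)) \<and>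
          (AE s in lborel. (\<lambda>k. F k s) \<longlonglongrightarrow> f s) \<and>
          (\<forall>B \<in> sets borel. \<exists>Z. tendsto_in_prob P (\<lambda>k. simple_levy_integral L (F k) B) Z) \<and>
          tendsto_in_prob P (\<lambda>k. simple_levy_integral L (F k) A) Y)"

definition levy_integrable ::
  "'w measure \<Rightarrow> ((real ^ 'm) set \<Rightarrow> 'w \<Rightarrow> real ^ 'd) \<Rightarrow> (real ^ 'm \<Rightarrow> real ^ 'd ^ 'n) \<Rightarrow> bool" where
  "levy_integrable P L f \<longleftrightarrow> (\<exists>Y. has_levy_integral P L f UNIV Y)"

section \<open>Weak dependence\<close>

text \<open>Points of $(\mathbf{R}^n)^u$ are the extensional functions on \<open>{..<u}\<close>.\<close>

abbreviation tuples :: "nat \<Rightarrow> (nat \<Rightarrow> real ^ 'n) set" where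
  "tuples u \<equiv> {..<u} \<rightarrow>\<^sub>E UNIV"

definition tuple_lipschitz :: "nat \<Rightarrow> real \<Rightarrow> ((nat \<Rightarrow> real ^ 'n) \<Rightarrow> real) \<Rightarrow> bool" where
  "tuple_lipschitz u K F \<longleftrightarrow>
     0 \<le> K \<and> (\<forall>x \<in> tuples u. \<forall>y \<in> tuples u. \<bar>F x - F y\<bar> \<le> K * (\<Sum>i<u. norm (x i - y i)))"

definition Lip :: "nat \<Rightarrow> ((nat \<Rightarrow> real ^ 'n) \<Rightarrow> real) \<Rightarrow> real" where
  "Lip u F = Inf {K. tuple_lipschitz u K F}"

definition sup_norm :: "nat \<Rightarrow> ((nat \<Rightarrow> real ^ 'n) \<Rightarrow> real) \<Rightarrow> real" where
  "sup_norm u F = (SUP x \<in> tuples u. \<bar>F x\<bar>)"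

definition test_functions :: "nat \<Rightarrow> ((nat \<Rightarrow> real ^ 'n) \<Rightarrow> real) set" where
  "test_functions u = {F. bounded (F ` tuples u) \<and> (\<exists>K. tuple_lipschitz u K F)}"

definition covariance :: "'w measure \<Rightarrow> ('w \<Rightarrow> real) \<Rightarrow> ('w \<Rightarrow> real) \<Rightarrow> real" where
  "covariance P U V = (LINT \<omega>|P. (U \<omega> - (LINT \<omega>|P. U \<omega>)) * (V \<omega> - (LINT \<omega>|P. V \<omega>)))"

definition sample ::
  "(real ^ 'm \<Rightarrow> 'w \<Rightarrow> real ^ 'n) \<Rightarrow> nat \<Rightarrow> (nat \<Rightarrow> real ^ 'm) \<Rightarrow> 'w \<Rightarrow> nat \<Rightarrow> real ^ 'n" where
  "sample X u \<Gamma> \<omega> = (\<lambda>i\<in>{..<u}. X (\<Gamma> i) \<omega>)"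

definition separated :: "nat \<Rightarrow> (nat \<Rightarrow> real ^ 'm) \<Rightarrow> nat \<Rightarrow> (nat \<Rightarrow> real ^ 'm) \<Rightarrow> real \<Rightarrow> bool" where
  "separated u \<Gamma> v \<Delta> h \<longleftrightarrow> (\<forall>i<u. \<forall>j<v. infnorm (\<Gamma> i - \<Delta> j) \<ge> h)"

definition eta_denom ::
  "nat \<Rightarrow> nat \<Rightarrow> ((nat \<Rightarrow> real ^ 'n) \<Rightarrow> real) \<Rightarrow> ((nat \<Rightarrow> real ^ 'n) \<Rightarrow> real) \<Rightarrow> real" where
  "eta_denom u v F G = real u * sup_norm v G * Lip u F + real v * sup_norm u F * Lip v G"

text \<open>
  An index set of cardinality \<open>u\<close> is enumerated by a map that is injective on \<open>{..<u}\<close>. The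
  suprema are taken in the extended nonnegative reals, so that they always exist.
\<close>

definition eta_uv ::
  "'w measure \<Rightarrow> (real ^ 'm \<Rightarrow> 'w \<Rightarrow> real ^ 'n) \<Rightarrow> nat \<Rightarrow> nat \<Rightarrow> real \<Rightarrow> ennreal" where
  "eta_uv P X u v h =
     (SUP (F, G, \<Gamma>, \<Delta>) \<in> {(F, G, \<Gamma>, \<Delta>).
          F \<in> test_functions u \<and> G \<in> test_functions v \<and> eta_denom u v F G \<noteq> 0 \<and>
          inj_on \<Gamma> {..<u} \<and> inj_on \<Delta> {..<v} \<and> separated u \<Gamma> v \<Delta> h}.
        ennreal (\<bar>covariance P (\<lambda>\<omega>. F (sample X u \<Gamma> \<omega>)) (\<lambda>\<omega>. G (sample X v \<Delta> \<omega>))\<bar>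
                   / eta_denom u v F G))"

definition eta_coeff ::
  "'w measure \<Rightarrow> (real ^ 'm \<Rightarrow> 'w \<Rightarrow> real ^ 'n) \<Rightarrow> real \<Rightarrow> ennreal" where
  "eta_coeff P X h = (SUP u \<in> {1..}. SUP v \<in> {1..}. eta_uv P X u v h)"

definition eta_weakly_dependent ::
  "'w measure \<Rightarrow> (real ^ 'm \<Rightarrow> 'w \<Rightarrow> real ^ 'n) \<Rightarrow> bool" where
  "eta_weakly_dependent P X \<longleftrightarrow> (eta_coeff P X \<longlongrightarrow> 0) at_top"

end

theory Submission
  imports Defs "HOL-Real_Asymp.Real_Asymp"
begin

text \<open>
  The value \<open>X t\<close> depends on the noise mainly near \<open>t\<close>: cutting the kernel off at distance
  \<open>h / 2\<close> changes the integral, in \<open>L\<^sup>2\<close>, by an amount that is exponentially small in \<open>h\<close>. For index sets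
  that are \<open>h\<close> apart the truncated fields are functions of the noise on disjoint sets, hence
  independent. The covariance of bounded Lipschitz functions is therefore bounded by the mean
  truncation error, multiplied by exactly the quantity by which the \<open>\<eta>\<close>-coefficients are normalised
  (\<open>eta_coeff_le_simple_approx\<close>).

  The \<open>L\<^sup>2\<close> control comes from the characteristic function. The assumptions on the jump measure make
  the exponent quadratically small at the origin, so the values of the Levy basis are centred with
  second moments bounded by Lebesgue measure (\<open>levy_basis_moments\<close>). With independence this gives
  an Ito-type inequality for simple integrands (\<open>simple_levy_integral_L2_bound\<close>), and hence the
  integrability of every square-integrable kernel (\<open>levy_integrable_L2\<close>).

  The integral is defined by arbitrary almost everywhere approximations whose integrals converge in
  probability over every Borel set, and such an approximation need not converge in \<open>L\<^sup>2\<close>. A gliding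
  hump argument (\<open>limit_of_null_sequence\<close>) shows that the limit does not depend on the approximation.
  Consequently every version of the integral satisfies the Ito-type inequality, and its \<open>L\<^sup>2\<close> distance
  to the integral of a simple function is controlled by the distance of the integrands
  (\<open>has_levy_integral_L2_dist\<close>). As simple functions can be chosen with support near \<open>t\<close>
  (\<open>truncated_simple_approx\<close>), only the independence of simple integrals with disjoint supports is
  needed (\<open>covariance_disjoint_supports\<close>).
\<close>

section \<open>The first two moments of a centred Levy basis\<close>

lemma norm_exp_minus_one_le:
  fixes z :: complex
  assumes "norm z \<le> 1 / 2"
  shows "norm (exp z - 1) \<le> 2 * norm z"
proof -
  have "norm (exp z - exp 0) \<le> 2 * norm (z - 0)"
  proof (rule field_differentiable_bound[of "cball 0 (1/2)" exp exp])
    show "norm (exp w) \<le> 2" if "w \<in> cball 0 (1/2)" for w :: complex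
      using that by (intro exp_bound_half) auto
  qed (use assms in \<open>auto intro!: derivative_eq_intros\<close>)
  then show ?thesis by simp
qed

lemma tendsto_cos_quotient:
  fixes z \<delta> :: real
  assumes "\<delta> > 0"
  shows "(\<lambda>n. 2 * (1 - cos (\<delta> / real (Suc n) * z)) / (\<delta> / real (Suc n))\<^sup>2) \<longlonglongrightarrow> z\<^sup>2"
proof -
  have "((\<lambda>a. 2 * (1 - cos (a * z)) / a\<^sup>2) \<longlongrightarrow> z\<^sup>2) (at_right 0)"
    by (real_asymp simp: power2_eq_square)
  moreover have "filterlim (\<lambda>n. \<delta> / real (Suc n)) (at_right 0) sequentially"
    using assms by real_asymp
  ultimately show ?thesis by (rule filterlim_compose)
qed

lemma norm_iexp_taylor2: "cmod (iexp x - 1 - \<i> * of_real x) \<le> x\<^sup>2 / 2"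
  using iexp_approx1[of x 1] by (simp add: numeral_2_eq_2[symmetric] algebra_simps)

text \<open>
  A characteristic function that is quadratically close to 1 at the origin forces a finite second
  moment: \<open>2 * (1 - cos (t * Z)) / t\<^sup>2\<close> tends to \<open>Z\<^sup>2\<close>, and Fatou's lemma applies. The mean then
  vanishes because it is the linear term of the expansion of the characteristic function at 0.
\<close>
lemma (in prob_space) moments_from_char_fun:
  fixes Z :: "'a \<Rightarrow> real"
  assumes [measurable]: "Z \<in> borel_measurable M"
    and "0 \<le> C" "0 < \<delta>"
    and char: "\<And>t. \<bar>t\<bar> \<le> \<delta> \<Longrightarrow> cmod ((LINT \<omega>|M. iexp (t * Z \<omega>)) - 1) \<le> C * t\<^sup>2"
  shows "(\<integral>\<^sup>+ \<omega>. ennreal ((Z \<omega>)\<^sup>2) \<partial>M) \<le> ennreal (2 * C)" "expectation Z = 0"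
proof -
  define a where "a n = \<delta> / real (Suc n)" for n
  have a: "0 < a n" "a n \<le> \<delta>" for n
    using \<open>0 < \<delta>\<close> by (auto simp: a_def field_simps intro: order_trans[of _ "\<delta> * 1"])
  have int_iexp: "integrable M (\<lambda>\<omega>. iexp (t * Z \<omega>))" for t
    using integrable_iexp[of "\<lambda>\<omega>. complex_of_real (t * Z \<omega>)"] by simp
  have int_cos: "integrable M (\<lambda>\<omega>. cos (t * Z \<omega>))" for t
    by (rule integrable_const_bound[of _ 1]) auto
  have approx: "(\<integral>\<^sup>+ \<omega>. ennreal (2 * (1 - cos (a n * Z \<omega>)) / (a n)\<^sup>2) \<partial>M) \<le> ennreal (2 * C)" for n
  proof -
    have "expectation (\<lambda>\<omega>. 1 - cos (a n * Z \<omega>)) = 1 - Re (LINT \<omega>|M. iexp (a n * Z \<omega>))"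
      using int_iexp[of "a n"] int_cos[of "a n"]
      by (subst integral_Re[symmetric]) (auto simp: prob_space Re_exp)
    also have "\<dots> \<le> C * (a n)\<^sup>2"
      using char[of "a n"] a[of n] abs_Re_le_cmod[of "(LINT \<omega>|M. iexp (a n * Z \<omega>)) - 1"]
      by auto
    finally have 1: "2 * expectation (\<lambda>\<omega>. 1 - cos (a n * Z \<omega>)) / (a n)\<^sup>2 \<le> 2 * C"
      using a(1)[of n] by (simp add: field_simps)
    have "(\<integral>\<^sup>+ \<omega>. ennreal (2 * (1 - cos (a n * Z \<omega>)) / (a n)\<^sup>2) \<partial>M)
        = ennreal (expectation (\<lambda>\<omega>. 2 * (1 - cos (a n * Z \<omega>)) / (a n)\<^sup>2))"
      using int_cos[of "a n"] by (intro nn_integral_eq_integral) auto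
    also have "\<dots> = ennreal (2 * expectation (\<lambda>\<omega>. 1 - cos (a n * Z \<omega>)) / (a n)\<^sup>2)"
      by (simp only: integral_mult_right_zero integral_divide_zero)
    finally show ?thesis using 1 by (simp add: ennreal_leI)
  qed
  have "(\<integral>\<^sup>+ \<omega>. ennreal ((Z \<omega>)\<^sup>2) \<partial>M)
      = (\<integral>\<^sup>+ \<omega>. liminf (\<lambda>n. ennreal (2 * (1 - cos (a n * Z \<omega>)) / (a n)\<^sup>2)) \<partial>M)"
  proof (intro nn_integral_cong)
    fix \<omega>
    have "(\<lambda>n. ennreal (2 * (1 - cos (a n * Z \<omega>)) / (a n)\<^sup>2)) \<longlonglongrightarrow> ennreal ((Z \<omega>)\<^sup>2)"
      unfolding a_def by (intro tendsto_ennrealI tendsto_cos_quotient \<open>0 < \<delta>\<close>)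
    from lim_imp_Liminf[OF _ this]
    show "ennreal ((Z \<omega>)\<^sup>2) = liminf (\<lambda>n. ennreal (2 * (1 - cos (a n * Z \<omega>)) / (a n)\<^sup>2))"
      by simp
  qed
  also have "\<dots> \<le> liminf (\<lambda>n. \<integral>\<^sup>+ \<omega>. ennreal (2 * (1 - cos (a n * Z \<omega>)) / (a n)\<^sup>2) \<partial>M)"
    by (rule nn_integral_liminf) auto
  also have "\<dots> \<le> limsup (\<lambda>n. \<integral>\<^sup>+ \<omega>. ennreal (2 * (1 - cos (a n * Z \<omega>)) / (a n)\<^sup>2) \<partial>M)"
    by (rule Liminf_le_Limsup) simp
  also have "\<dots> \<le> ennreal (2 * C)"
    by (rule Limsup_bounded, rule always_eventually, rule allI, rule approx)
  finally show second: "(\<integral>\<^sup>+ \<omega>. ennreal ((Z \<omega>)\<^sup>2) \<partial>M) \<le> ennreal (2 * C)" .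
  then have int2: "integrable M (\<lambda>\<omega>. (Z \<omega>)\<^sup>2)"
    by (intro integrableI_bounded) (auto intro: le_less_trans[OF _ ennreal_less_top])
  then have int1: "integrable M Z"
    by (intro square_integrable_imp_integrable[OF _ int2]) simp
  have tendsto_a: "(\<lambda>n. e * (\<delta> / real (Suc n))) \<longlonglongrightarrow> 0" for e
    by real_asymp
  \<comment> \<open>Comparing \<open>E[iexp (t * Z)]\<close> with its first-order Taylor polynomial leaves \<open>t * E[Z] = O(t\<^sup>2)\<close>.\<close>
  have "\<bar>expectation Z\<bar> \<le> (C + expectation (\<lambda>\<omega>. (Z \<omega>)\<^sup>2)) * a n" for n
  proof -
    have int_Z: "integrable M (\<lambda>\<omega>. \<i> * complex_of_real (a n * Z \<omega>))"
      using int1 by auto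
    have eq: "(LINT \<omega>|M. iexp (a n * Z \<omega>) - 1 - \<i> * complex_of_real (a n * Z \<omega>))
        = (LINT \<omega>|M. iexp (a n * Z \<omega>)) - 1 - \<i> * complex_of_real (a n * expectation Z)"
      by (subst Bochner_Integration.integral_diff, use int_iexp[of "a n"] int_Z in simp, fact int_Z,
          subst Bochner_Integration.integral_diff)
         (use int_iexp[of "a n"] in \<open>simp_all add: prob_space\<close>)
    have "cmod (LINT \<omega>|M. iexp (a n * Z \<omega>) - 1 - \<i> * complex_of_real (a n * Z \<omega>))
        \<le> expectation (\<lambda>\<omega>. cmod (iexp (a n * Z \<omega>) - 1 - \<i> * complex_of_real (a n * Z \<omega>)))"
      by (rule integral_norm_bound)
    also have "\<dots> \<le> expectation (\<lambda>\<omega>. (a n)\<^sup>2 * (Z \<omega>)\<^sup>2)"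
    proof (rule integral_mono)
      show "integrable M (\<lambda>\<omega>. cmod (iexp (a n * Z \<omega>) - 1 - \<i> * complex_of_real (a n * Z \<omega>)))"
        using int_iexp[of "a n"] int_Z
        by (intro integrable_norm Bochner_Integration.integrable_diff) auto
      show "cmod (iexp (a n * Z \<omega>) - 1 - \<i> * complex_of_real (a n * Z \<omega>)) \<le> (a n)\<^sup>2 * (Z \<omega>)\<^sup>2" for \<omega>
        unfolding power_mult_distrib[symmetric]
        using norm_iexp_taylor2[of "a n * Z \<omega>"] zero_le_power2[of "a n * Z \<omega>"] by linarith
    qed (use int2 in auto)
    finally have taylor: "cmod ((LINT \<omega>|M. iexp (a n * Z \<omega>)) - 1 - \<i> * complex_of_real (a n * expectation Z))
        \<le> (a n)\<^sup>2 * expectation (\<lambda>\<omega>. (Z \<omega>)\<^sup>2)"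
      unfolding eq by simp
    have "a n * \<bar>expectation Z\<bar> = cmod (\<i> * complex_of_real (a n * expectation Z))"
      using a(1)[of n] by (simp add: norm_mult abs_mult)
    also have "\<dots> \<le> cmod ((LINT \<omega>|M. iexp (a n * Z \<omega>)) - 1)
        + cmod ((LINT \<omega>|M. iexp (a n * Z \<omega>)) - 1 - \<i> * complex_of_real (a n * expectation Z))"
      using norm_triangle_ineq4[of "(LINT \<omega>|M. iexp (a n * Z \<omega>)) - 1"
        "(LINT \<omega>|M. iexp (a n * Z \<omega>)) - 1 - \<i> * complex_of_real (a n * expectation Z)"]
      by simp
    also have "\<dots> \<le> C * (a n)\<^sup>2 + (a n)\<^sup>2 * expectation (\<lambda>\<omega>. (Z \<omega>)\<^sup>2)"
      using char[of "a n"] a[of n] taylor by (intro add_mono) auto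
    also have "\<dots> = a n * ((C + expectation (\<lambda>\<omega>. (Z \<omega>)\<^sup>2)) * a n)"
      by (simp add: algebra_simps power2_eq_square)
    finally show ?thesis using a(1)[of n] by simp
  qed
  moreover have "(\<lambda>n. (C + expectation (\<lambda>\<omega>. (Z \<omega>)\<^sup>2)) * a n) \<longlonglongrightarrow> 0"
    unfolding a_def using tendsto_a by simp
  ultimately have "\<bar>expectation Z\<bar> \<le> 0"
    by (intro LIMSEQ_le_const[of "\<lambda>n. (C + expectation (\<lambda>\<omega>. (Z \<omega>)\<^sup>2)) * a n"]) auto
  then show "expectation Z = 0" by simp
qed

lemma norm_iexp_inner_taylor2:
  "cmod (iexp (u \<bullet> x) - 1 - \<i> * of_real (u \<bullet> x)) \<le> (norm u)\<^sup>2 * (norm x)\<^sup>2"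
proof -
  have "(u \<bullet> x)\<^sup>2 \<le> (norm u * norm x)\<^sup>2"
    using Cauchy_Schwarz_ineq2[of u x] by (metis abs_ge_zero power2_abs power_mono)
  then have "(u \<bullet> x)\<^sup>2 / 2 \<le> (norm u)\<^sup>2 * (norm x)\<^sup>2"
    by (simp add: power_mult_distrib) (smt (verit) zero_le_power2)
  with norm_iexp_taylor2[of "u \<bullet> x"] show ?thesis by simp
qed

text \<open>
  Under the centring condition the drift cancels against the compensator of the large jumps, so
  that the exponent takes the form in which every jump is compensated, without a linear term.
\<close>
lemma levy_exponent_centred:
  fixes \<nu> :: "(real ^ 'd) measure"
  assumes \<nu>: "levy_measure \<nu>"
    and tail: "(\<integral>\<^sup>+ x \<in> {x. norm x > 1}. ennreal ((norm x)\<^sup>2) \<partial>\<nu>) < \<infinity>"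
    and centred: "\<gamma> + (LINT x : {x. norm x > 1} | \<nu>. x) = 0"
  shows "integrable \<nu> (\<lambda>x. (norm x)\<^sup>2)"
    and "levy_exponent \<gamma> \<Sigma> \<nu> u
      = - of_real (u \<bullet> (\<Sigma> *v u)) / 2 + (LINT x|\<nu>. iexp (u \<bullet> x) - 1 - \<i> * of_real (u \<bullet> x))"
proof -
  have [measurable_cong]: "sets \<nu> = sets borel" using \<nu> by (simp add: levy_measure_def)
  have small: "(\<integral>\<^sup>+ x. ennreal (min 1 ((norm x)\<^sup>2)) \<partial>\<nu>) < \<infinity>" using \<nu> by (simp add: levy_measure_def)
  have "(\<integral>\<^sup>+ x. ennreal ((norm x)\<^sup>2) \<partial>\<nu>)
      \<le> (\<integral>\<^sup>+ x. ennreal (min 1 ((norm x)\<^sup>2)) + ennreal ((norm x)\<^sup>2) * indicator {x. norm x > 1} x \<partial>\<nu>)"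
    by (intro nn_integral_mono)
       (auto simp: indicator_def min_def not_less power_le_one_iff abs_square_le_1 ennreal_leI)
  also have "\<dots> < \<infinity>"
    using small tail by (subst nn_integral_add) auto
  finally show sq: "integrable \<nu> (\<lambda>x. (norm x)\<^sup>2)"
    by (intro integrableI_bounded) auto
  have int2: "integrable \<nu> (\<lambda>x. iexp (u \<bullet> x) - 1 - \<i> * of_real (u \<bullet> x))"
  proof (rule Bochner_Integration.integrable_bound)
    show "integrable \<nu> (\<lambda>x. (norm u)\<^sup>2 * (norm x)\<^sup>2)" using sq by simp
    show "AE x in \<nu>. cmod (iexp (u \<bullet> x) - 1 - \<i> * of_real (u \<bullet> x)) \<le> norm ((norm u)\<^sup>2 * (norm x)\<^sup>2)"
      using norm_iexp_inner_taylor2[of u] by (intro AE_I2) simp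
  qed auto
  have big: "set_integrable \<nu> {x. norm x > 1} (\<lambda>x. x)"
    unfolding set_integrable_def
  proof (rule Bochner_Integration.integrable_bound[OF sq])
    show "AE x in \<nu>. norm (indicator {x. 1 < norm x} x *\<^sub>R x) \<le> norm ((norm x)\<^sup>2)"
      by (intro AE_I2) (auto simp: indicator_def power2_eq_square mult_le_cancel_left1 not_less)
  qed auto
  have u_big: "(LINT x|\<nu>. \<i> * of_real (u \<bullet> (indicator {x. norm x > 1} x *\<^sub>R x))) = - \<i> * of_real (\<gamma> \<bullet> u)"
  proof -
    have "(LINT x|\<nu>. u \<bullet> (indicator {x. norm x > 1} x *\<^sub>R x)) = u \<bullet> (LINT x : {x. norm x > 1} | \<nu>. x)"
      using big unfolding set_integrable_def set_lebesgue_integral_def by (intro integral_inner_right) auto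
    also have "\<dots> = - (\<gamma> \<bullet> u)"
      using centred by (simp add: add_eq_0_iff inner_commute)
    finally show ?thesis
      using integral_complex_of_real[of \<nu> "\<lambda>x. u \<bullet> (indicator {x. norm x > 1} x *\<^sub>R x)"]
      by (simp del: integral_complex_of_real)
  qed
  have int_big: "integrable \<nu> (\<lambda>x. \<i> * of_real (u \<bullet> (indicator {x. norm x > 1} x *\<^sub>R x)) :: complex)"
    using big unfolding set_integrable_def by (intro integrable_mult_right integrable_of_real integrable_inner_right) auto
  have "(LINT x|\<nu>. iexp (u \<bullet> x) - 1 - \<i> * of_real (u \<bullet> x) * of_real (indicator {0..1} (norm x)))
      = (LINT x|\<nu>. (iexp (u \<bullet> x) - 1 - \<i> * of_real (u \<bullet> x))
          + \<i> * of_real (u \<bullet> (indicator {x. norm x > 1} x *\<^sub>R x)))"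
    by (intro Bochner_Integration.integral_cong) (auto simp: indicator_def)
  also have "\<dots> = (LINT x|\<nu>. iexp (u \<bullet> x) - 1 - \<i> * of_real (u \<bullet> x)) - \<i> * of_real (\<gamma> \<bullet> u)"
    using int2 int_big u_big by (subst Bochner_Integration.integral_add) auto
  finally show "levy_exponent \<gamma> \<Sigma> \<nu> u
      = - of_real (u \<bullet> (\<Sigma> *v u)) / 2 + (LINT x|\<nu>. iexp (u \<bullet> x) - 1 - \<i> * of_real (u \<bullet> x))"
    by (simp add: levy_exponent_def)
qed

lemma levy_exponent_quadratic_bound:
  fixes \<nu> :: "(real ^ 'd) measure"
  assumes "levy_measure \<nu>"
    and "(\<integral>\<^sup>+ x \<in> {x. norm x > 1}. ennreal ((norm x)\<^sup>2) \<partial>\<nu>) < \<infinity>"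
    and "\<gamma> + (LINT x : {x. norm x > 1} | \<nu>. x) = 0"
  shows "\<exists>C>0. \<forall>u. cmod (levy_exponent \<gamma> \<Sigma> \<nu> u) \<le> C * (norm u)\<^sup>2"
proof -
  note \<nu> = levy_exponent_centred[OF assms]
  have [measurable_cong]: "sets \<nu> = sets borel" using assms(1) by (simp add: levy_measure_def)
  define S where "S = onorm ((*v) \<Sigma>)"
  define V where "V = (LINT x|\<nu>. (norm x)\<^sup>2)"
  have "0 \<le> S" unfolding S_def by (intro onorm_pos_le) (simp add: linear_linear)
  have "0 \<le> V" unfolding V_def by simp
  have "cmod (levy_exponent \<gamma> \<Sigma> \<nu> u) \<le> (S + V + 1) * (norm u)\<^sup>2" for u
  proof -
    have "\<bar>u \<bullet> (\<Sigma> *v u)\<bar> \<le> norm u * norm (\<Sigma> *v u)" by (rule Cauchy_Schwarz_ineq2)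
    also have "\<dots> \<le> norm u * (S * norm u)"
      unfolding S_def by (intro mult_left_mono onorm) (simp_all add: linear_linear)
    finally have gauss: "\<bar>u \<bullet> (\<Sigma> *v u)\<bar> \<le> S * (norm u)\<^sup>2" by (simp add: power2_eq_square mult_ac)
    have "cmod (LINT x|\<nu>. iexp (u \<bullet> x) - 1 - \<i> * of_real (u \<bullet> x)) \<le> (LINT x|\<nu>. (norm u)\<^sup>2 * (norm x)\<^sup>2)"
    proof (rule order_trans[OF integral_norm_bound integral_mono])
      show "integrable \<nu> (\<lambda>x. (norm u)\<^sup>2 * (norm x)\<^sup>2)" using \<nu>(1) by simp
      show bound: "cmod (iexp (u \<bullet> x) - 1 - \<i> * of_real (u \<bullet> x)) \<le> (norm u)\<^sup>2 * (norm x)\<^sup>2" for x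
        by (rule norm_iexp_inner_taylor2)
      show "integrable \<nu> (\<lambda>x. cmod (iexp (u \<bullet> x) - 1 - \<i> * of_real (u \<bullet> x)))"
        by (rule Bochner_Integration.integrable_bound[OF \<open>integrable \<nu> (\<lambda>x. (norm u)\<^sup>2 * (norm x)\<^sup>2)\<close>])
           (use bound in auto)
    qed
    also have "\<dots> = V * (norm u)\<^sup>2" by (simp add: V_def)
    finally have jump: "cmod (LINT x|\<nu>. iexp (u \<bullet> x) - 1 - \<i> * of_real (u \<bullet> x)) \<le> V * (norm u)\<^sup>2" .
    have "cmod (levy_exponent \<gamma> \<Sigma> \<nu> u) \<le> \<bar>u \<bullet> (\<Sigma> *v u)\<bar> / 2 + V * (norm u)\<^sup>2"
      unfolding \<nu>(2) by (rule norm_triangle_le) (use jump in \<open>simp add: norm_divide\<close>)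
    also have "\<dots> \<le> (S + V + 1) * (norm u)\<^sup>2"
      using gauss mult_nonneg_nonneg[OF \<open>0 \<le> S\<close> zero_le_power2[of "norm u"]]
      unfolding distrib_right using zero_le_power2[of "norm u"] by linarith
    finally show ?thesis .
  qed
  moreover have "S + V + 1 > 0" using \<open>0 \<le> S\<close> \<open>0 \<le> V\<close> by simp
  ultimately show ?thesis by blast
qed

text \<open>
  This is what the integration theory below draws from the characteristic triplet: by the quadratic
  bound on the exponent, the characteristic function of a projection of \<open>L B\<close> differs from 1
  near the origin by at most a quadratic term, with a coefficient proportional to the volume of \<open>B\<close>.
\<close>
lemma levy_basis_moments:
  fixes \<nu> :: "(real ^ 'd) measure" and L :: "(real ^ 'm) set \<Rightarrow> 'w \<Rightarrow> real ^ 'd"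
  assumes "levy_basis P L \<gamma> \<Sigma> \<nu>"
    and "(\<integral>\<^sup>+ x \<in> {x. norm x > 1}. ennreal ((norm x)\<^sup>2) \<partial>\<nu>) < \<infinity>"
    and "\<gamma> + (LINT x : {x. norm x > 1} | \<nu>. x) = 0"
  shows "\<exists>c>0. \<forall>B u. bounded_borel B \<longrightarrow>
    (\<integral>\<^sup>+ \<omega>. ennreal ((u \<bullet> L B \<omega>)\<^sup>2) \<partial>P) \<le> ennreal (c * (norm u)\<^sup>2 * measure lborel B) \<and>
    (LINT \<omega>|P. u \<bullet> L B \<omega>) = 0"
proof -
  interpret levy_basis P L \<gamma> \<Sigma> \<nu> by fact
  obtain C where "C > 0" and C: "\<And>u. cmod (levy_exponent \<gamma> \<Sigma> \<nu> u) \<le> C * (norm u)\<^sup>2"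
    using levy_exponent_quadratic_bound[OF levy_measure assms(2,3)] by blast
  have "(\<integral>\<^sup>+ \<omega>. ennreal ((u \<bullet> L B \<omega>)\<^sup>2) \<partial>P) \<le> ennreal (4 * C * (norm u)\<^sup>2 * measure lborel B) \<and>
      (LINT \<omega>|P. u \<bullet> L B \<omega>) = 0" if B: "bounded_borel B" for B u
  proof -
    define D where "D = C * (norm u)\<^sup>2 * measure lborel B"
    \<comment> \<open>This radius keeps the exponent at most 1/2 in modulus, where \<open>exp z - 1\<close> is of order \<open>z\<close>.\<close>
    define \<delta> where "\<delta> = 1 / sqrt (2 * D + 1)"
    have "0 \<le> D" using \<open>C > 0\<close> by (simp add: D_def)
    have "0 < \<delta>" using \<open>0 \<le> D\<close> by (simp add: \<delta>_def)
    have [measurable]: "L B \<in> borel_measurable P" using B by (rule random_variable)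
    have char: "cmod ((LINT \<omega>|P. iexp (t * (u \<bullet> L B \<omega>))) - 1) \<le> (2 * D) * t\<^sup>2" if t: "\<bar>t\<bar> \<le> \<delta>" for t
    proof -
      let ?z = "levy_exponent \<gamma> \<Sigma> \<nu> (t *\<^sub>R u) * of_real (measure lborel B)"
      have "cmod ?z \<le> C * (norm (t *\<^sub>R u))\<^sup>2 * measure lborel B"
        unfolding norm_mult using C[of "t *\<^sub>R u"] \<open>C > 0\<close> by (intro mult_mono) auto
      also have "\<dots> = D * t\<^sup>2" by (simp add: D_def power_mult_distrib mult_ac)
      finally have z: "cmod ?z \<le> D * t\<^sup>2" .
      have "t\<^sup>2 \<le> \<delta>\<^sup>2" using t \<open>0 < \<delta>\<close> by (simp flip: abs_le_square_iff)
      also have "\<delta>\<^sup>2 = 1 / (2 * D + 1)" using \<open>0 \<le> D\<close> by (simp add: \<delta>_def power_divide)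
      finally have "D * t\<^sup>2 \<le> D * (1 / (2 * D + 1))" using \<open>0 \<le> D\<close> by (rule mult_left_mono)
      also have "\<dots> \<le> 1 / 2" using \<open>0 \<le> D\<close> by (simp add: field_simps)
      finally have "cmod ?z \<le> 1 / 2" using z by simp
      then have "cmod (exp ?z - 1) \<le> 2 * cmod ?z" by (rule norm_exp_minus_one_le)
      then show ?thesis using z char_fun[OF B, of "t *\<^sub>R u"] by simp
    qed
    have "(\<lambda>\<omega>. u \<bullet> L B \<omega>) \<in> borel_measurable P" "0 \<le> 2 * D" using \<open>0 \<le> D\<close> by auto
    note moments = moments_from_char_fun[OF this \<open>0 < \<delta>\<close> char]
    have "2 * (2 * D) = 4 * C * (norm u)\<^sup>2 * measure lborel B" by (simp add: D_def)
    with moments show ?thesis by (metis (no_types))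
  qed
  with \<open>C > 0\<close> show ?thesis by (intro exI[of _ "4 * C"]) auto
qed

section \<open>Integrals of simple functions\<close>

text \<open>
  Bienayme's identity: the cross terms vanish, since each is a product of independent centred
  variables.
\<close>
lemma (in prob_space) second_moment_sum_indep:
  fixes Y :: "'i \<Rightarrow> 'a \<Rightarrow> real"
  assumes "finite R" "indep_vars (\<lambda>_. borel) Y R"
    and "\<And>b. b \<in> R \<Longrightarrow> integrable M (\<lambda>\<omega>. (Y b \<omega>)\<^sup>2)"
    and "\<And>b. b \<in> R \<Longrightarrow> expectation (Y b) = 0"
  shows "integrable M (\<lambda>\<omega>. (\<Sum>b\<in>R. Y b \<omega>)\<^sup>2)"
    and "expectation (\<lambda>\<omega>. (\<Sum>b\<in>R. Y b \<omega>)\<^sup>2) = (\<Sum>b\<in>R. expectation (\<lambda>\<omega>. (Y b \<omega>)\<^sup>2))"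
proof -
  have "integrable M (\<lambda>\<omega>. (\<Sum>b\<in>R. Y b \<omega>)\<^sup>2) \<and>
    expectation (\<lambda>\<omega>. (\<Sum>b\<in>R. Y b \<omega>)\<^sup>2) = (\<Sum>b\<in>R. expectation (\<lambda>\<omega>. (Y b \<omega>)\<^sup>2))"
    using assms
  proof (induction R)
    case (insert x R)
    let ?S = "\<lambda>\<omega>. \<Sum>b\<in>R. Y b \<omega>"
    have ind: "indep_vars (\<lambda>_. borel) Y R" using insert.prems(1) by (rule indep_vars_subset) auto
    have IH: "integrable M (\<lambda>\<omega>. (?S \<omega>)\<^sup>2)"
      "expectation (\<lambda>\<omega>. (?S \<omega>)\<^sup>2) = (\<Sum>b\<in>R. expectation (\<lambda>\<omega>. (Y b \<omega>)\<^sup>2))"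
      using insert.IH[OF ind] insert.prems by auto
    have meas: "Y b \<in> borel_measurable M" if "b \<in> insert x R" for b
      using insert.prems(1) that by (auto simp: indep_vars_def2)
    have int: "integrable M (Y b)" if "b \<in> insert x R" for b
      by (rule square_integrable_imp_integrable[OF meas[OF that] insert.prems(2)[OF that]])
    have "integrable M ?S" using int by auto
    have "indep_var borel (Y x) borel ?S"
      using insert by (intro indep_vars_sum) auto
    note xS = indep_var_integrable[OF this] indep_var_lebesgue_integral[OF this]
    have int_xS: "integrable M (\<lambda>\<omega>. Y x \<omega> * ?S \<omega>)"
      using xS(1) int \<open>integrable M ?S\<close> by auto
    have "expectation (\<lambda>\<omega>. Y x \<omega> * ?S \<omega>) = 0"
      using xS(2) int \<open>integrable M ?S\<close> insert.prems(3) by auto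
    moreover have "(\<lambda>\<omega>. (\<Sum>b\<in>insert x R. Y b \<omega>)\<^sup>2) = (\<lambda>\<omega>. ((Y x \<omega>)\<^sup>2 + (?S \<omega>)\<^sup>2) + 2 * (Y x \<omega> * ?S \<omega>))"
      using insert.hyps by (simp add: power2_sum fun_eq_iff mult.assoc)
    moreover have "integrable M (\<lambda>\<omega>. (Y x \<omega>)\<^sup>2)" using insert.prems by auto
    ultimately show ?case
      using IH int_xS insert.hyps by simp
  qed simp
  then show "integrable M (\<lambda>\<omega>. (\<Sum>b\<in>R. Y b \<omega>)\<^sup>2)"
    and "expectation (\<lambda>\<omega>. (\<Sum>b\<in>R. Y b \<omega>)\<^sup>2) = (\<Sum>b\<in>R. expectation (\<lambda>\<omega>. (Y b \<omega>)\<^sup>2))" by auto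
qed

lemma norm_vec_sq: "(norm (x :: ('a :: real_normed_vector) ^ 'n))\<^sup>2 = (\<Sum>i\<in>UNIV. (norm (x $ i))\<^sup>2)"
  by (simp add: norm_vec_def L2_set_def sum_nonneg)

lemma matrix_vector_measurable:
  fixes A :: "real ^ 'd ^ 'n"
  assumes "f \<in> borel_measurable M"
  shows "(\<lambda>x. A *v f x) \<in> borel_measurable M"
  by (rule borel_measurable_continuous_on[OF _ assms]) (simp add: linear_continuous_on linear_linear)

text \<open>
  Several simple functions are handled simultaneously by factoring all of them through one simple
  function \<open>T\<close>. Natural numbers serve as its values because the independence of a Levy basis is
  stated for sequences of sets, and the level sets of \<open>T\<close> then form such a sequence.
\<close>
lemma simple_function_code:
  assumes "simple_function M S"
  obtains T :: "'a \<Rightarrow> nat" and q where "simple_function M T" "\<And>s. s \<in> space M \<Longrightarrow> S s = q (T s)"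
proof
  have "finite (S ` space M)" using assms by (rule simple_functionD)
  then have c: "countable (S ` space M)" by (rule countable_finite)
  show "simple_function M (to_nat_on (S ` space M) \<circ> S)"
    using assms by (rule simple_function_compose)
  show "S s = from_nat_into (S ` space M) ((to_nat_on (S ` space M) \<circ> S) s)" if "s \<in> space M" for s
    using c that by simp
qed

lemma levy_simple_vimage:
  assumes "levy_simple f" "y \<noteq> 0" "A \<in> sets borel"
  shows "bounded_borel (A \<inter> f -` {y})"
proof
  have "simple_function borel f" using assms by (simp add: levy_simple_def)
  from simple_functionD(2)[OF this, of "{y}"] show "A \<inter> f -` {y} \<in> sets borel"
    using assms(3) by auto
  show "bounded (A \<inter> f -` {y})"
    using assms by (auto simp: levy_simple_def intro: bounded_subset)
qed

lemma finite_range_levy_simple: "levy_simple f \<Longrightarrow> finite (range f)"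
  using simple_functionD(1)[of borel f] by (simp add: levy_simple_def)

lemma levy_simple_diff:
  assumes "levy_simple f" "levy_simple g"
  shows "levy_simple (\<lambda>s. f s - g s)"
proof -
  have "{s. f s - g s \<noteq> 0} \<subseteq> {s. f s \<noteq> 0} \<union> {s. g s \<noteq> 0}" by auto
  moreover have "simple_function borel (\<lambda>s. f s - g s)"
    using assms by (intro simple_function_diff) (auto simp: levy_simple_def)
  ultimately show ?thesis
    using assms unfolding levy_simple_def by (meson bounded_Un bounded_subset)
qed

lemma levy_simple_measurable: "levy_simple f \<Longrightarrow> f \<in> borel_measurable borel"
  by (auto simp: levy_simple_def intro: borel_measurable_simple_function)

text \<open>
  The part of \<open>A\<close> in the level set of \<open>T\<close> over \<open>b\<close>. Unbounded level sets, to which a Levy basis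
  assigns no value, are replaced by the empty set; an integrand of bounded support that factors
  through \<open>T\<close> vanishes on them.
\<close>
definition cell :: "(real ^ 'm) set \<Rightarrow> (real ^ 'm \<Rightarrow> nat) \<Rightarrow> nat \<Rightarrow> (real ^ 'm) set" where
  "cell A T b = (if bounded (T -` {b}) then A \<inter> T -` {b} else {})"

lemma bounded_borel_cell:
  assumes "simple_function borel T" "A \<in> sets borel"
  shows "bounded_borel (cell A T b)"
  using simple_functionD(2)[OF assms(1), of "{b}"] assms(2)
  by (auto simp: cell_def intro: bounded_subset)

lemma disjoint_family_cell: "disjoint_family_on (cell A T) J"
  by (auto simp: disjoint_family_on_def cell_def)

text \<open>
  The constant \<open>c\<close> is a parameter so that it can be named in the estimates below; the characteristic
  triplet enters them through \<open>c\<close> only.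
\<close>
locale l2_levy_basis = levy_basis P L \<gamma> \<Sigma> \<nu>
  for P :: "'w measure"
    and L :: "(real ^ 'm) set \<Rightarrow> 'w \<Rightarrow> real ^ 'd"
    and \<gamma> \<Sigma> \<nu> +
  fixes c :: real
  assumes c_pos: "0 < c"
    and second_moment: "\<And>B u. bounded_borel B \<Longrightarrow>
      (\<integral>\<^sup>+ \<omega>. ennreal ((u \<bullet> L B \<omega>)\<^sup>2) \<partial>P) \<le> ennreal (c * (norm u)\<^sup>2 * measure lborel B)"
    and mean_zero: "\<And>B u. bounded_borel B \<Longrightarrow> (LINT \<omega>|P. u \<bullet> L B \<omega>) = 0"

context levy_basis
begin

lemma AE_empty: "AE \<omega> in P. L {} \<omega> = 0"
proof -
  have "AE \<omega> in P. (\<lambda>i::nat. L {} \<omega>) sums L (\<Union>i::nat. {}) \<omega>"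
    by (rule sigma_additive) (auto simp: disjoint_family_on_def)
  then show ?thesis
  proof (rule AE_mp, intro AE_I2 impI)
    fix \<omega> assume "(\<lambda>i::nat. L {} \<omega>) sums L (\<Union>i::nat. {}) \<omega>"
    then have "(\<lambda>i::nat. L {} \<omega>) \<longlonglongrightarrow> 0" by (intro summable_LIMSEQ_zero sums_summable)
    then show "L {} \<omega> = 0" by (simp add: LIMSEQ_const_iff)
  qed
qed

lemma finitely_additive:
  fixes B :: "nat \<Rightarrow> (real ^ 'm) set"
  assumes "finite J" "disjoint_family_on B J" "\<And>i. i \<in> J \<Longrightarrow> bounded_borel (B i)"
  shows "AE \<omega> in P. L (\<Union>i\<in>J. B i) \<omega> = (\<Sum>i\<in>J. L (B i) \<omega>)"
proof -
  define B' where "B' i = (if i \<in> J then B i else {})" for i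
  have U: "(\<Union>i. B' i) = (\<Union>i\<in>J. B i)" by (auto simp: B'_def split: if_splits)
  have "AE \<omega> in P. (\<lambda>i. L (B' i) \<omega>) sums L (\<Union>i. B' i) \<omega>"
  proof (rule sigma_additive)
    show "disjoint_family B'"
      using assms(2) by (auto simp: B'_def disjoint_family_on_def)
    show "bounded_borel (B' i)" for i using assms(3) by (auto simp: B'_def)
    show "bounded (\<Union>i. B' i)" unfolding U using assms(1,3) by (auto intro: bounded_UN)
  qed
  then show ?thesis
    using AE_empty
  proof eventually_elim
    case (elim \<omega>)
    have "(\<lambda>i. L (B' i) \<omega>) sums (\<Sum>i\<in>J. L (B' i) \<omega>)"
      using elim(2) by (intro sums_finite assms(1)) (auto simp: B'_def)
    with elim(1) have "L (\<Union>i. B' i) \<omega> = (\<Sum>i\<in>J. L (B' i) \<omega>)" by (rule sums_unique2)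
    then show ?case unfolding U by (simp add: B'_def)
  qed
qed

lemma simple_levy_integral_measurable [measurable]:
  fixes f :: "real ^ 'm \<Rightarrow> real ^ 'd ^ 'n"
  assumes "levy_simple f" "A \<in> sets borel"
  shows "simple_levy_integral L f A \<in> borel_measurable P"
proof -
  have *: "(\<lambda>\<omega>. y *v L (A \<inter> f -` {y}) \<omega>) \<in> borel_measurable P" if "y \<in> range f - {0}" for y
    using assms that by (intro matrix_vector_measurable random_variable levy_simple_vimage) auto
  have "(\<lambda>\<omega>. \<Sum>y\<in>range f - {0}. y *v L (A \<inter> f -` {y}) \<omega>) \<in> borel_measurable P"
    by (intro borel_measurable_sum *)
  then show ?thesis unfolding simple_levy_integral_def[abs_def] .
qed

text \<open>
  The canonical representation of a simple integral over its level sets may be replaced by any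
  refinement. This follows from finite additivity of \<open>L\<close>, hence holds only almost surely.
\<close>
lemma simple_levy_integral_coded:
  fixes q :: "nat \<Rightarrow> real ^ 'd ^ 'n" and T :: "real ^ 'm \<Rightarrow> nat"
  assumes T: "simple_function borel T" and A: "A \<in> sets borel" and f: "levy_simple f" "f = (\<lambda>s. q (T s))"
  shows "AE \<omega> in P. simple_levy_integral L f A \<omega> = (\<Sum>b\<in>range T. q b *v L (cell A T b) \<omega>)"
proof -
  have finT: "finite (range T)" using simple_functionD(1)[OF T] by simp
  have fin: "finite (range f)" using f(1) by (rule finite_range_levy_simple)
  define J where "J y = {b \<in> range T. q b = y}" for y
  have finJ: "finite (J y)" for y using finT by (simp add: J_def)
  have bdd: "bounded (T -` {b})" if "q b \<noteq> 0" for b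
  proof (rule bounded_subset)
    show "bounded {s. f s \<noteq> 0}" using f(1) by (simp add: levy_simple_def)
    show "T -` {b} \<subseteq> {s. f s \<noteq> 0}" using that f(2) by auto
  qed
  have un: "A \<inter> f -` {y} = (\<Union>b\<in>J y. cell A T b)" if "y \<noteq> 0" for y
    using bdd that unfolding f(2) by (auto simp: J_def cell_def)
  have "AE \<omega> in P. \<forall>y\<in>range f - {0}. L (A \<inter> f -` {y}) \<omega> = (\<Sum>b\<in>J y. L (cell A T b) \<omega>)"
  proof (rule AE_finite_allI)
    show "AE \<omega> in P. L (A \<inter> f -` {y}) \<omega> = (\<Sum>b\<in>J y. L (cell A T b) \<omega>)" if "y \<in> range f - {0}" for y
    proof -
      have "y \<noteq> 0" using that by simp
      show ?thesis unfolding un[OF \<open>y \<noteq> 0\<close>]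
        by (rule finitely_additive[OF finJ disjoint_family_cell bounded_borel_cell[OF T A]])
    qed
  qed (use fin in simp)
  then show ?thesis
  proof eventually_elim
    case (elim \<omega>)
    have "simple_levy_integral L f A \<omega> = (\<Sum>y\<in>range f - {0}. \<Sum>b\<in>J y. y *v L (cell A T b) \<omega>)"
      unfolding simple_levy_integral_def
      using elim by (intro sum.cong) (auto simp: linear_sum[OF matrix_vector_mul_linear])
    also have "\<dots> = (\<Sum>y\<in>range f - {0}. \<Sum>b\<in>J y. q b *v L (cell A T b) \<omega>)"
      by (intro sum.cong) (auto simp: J_def)
    also have "\<dots> = (\<Sum>y\<in>range f. \<Sum>b\<in>J y. q b *v L (cell A T b) \<omega>)"
      using fin by (intro sum.mono_neutral_left) (auto simp: J_def)
    also have "\<dots> = (\<Sum>b\<in>range T. q b *v L (cell A T b) \<omega>)"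
      unfolding J_def by (rule sum.group[OF finT fin]) (use f(2) in auto)
    finally show ?case .
  qed
qed

lemma simple_levy_integral_diff:
  fixes f g :: "real ^ 'm \<Rightarrow> real ^ 'd ^ 'n"
  assumes f: "levy_simple f" and g: "levy_simple g" and A: "A \<in> sets borel"
  shows "AE \<omega> in P. simple_levy_integral L (\<lambda>s. f s - g s) A \<omega>
    = simple_levy_integral L f A \<omega> - simple_levy_integral L g A \<omega>"
proof -
  have "simple_function borel (\<lambda>s. (f s, g s))"
    using f g by (intro simple_function_Pair) (auto simp: levy_simple_def)
  then obtain T :: "real ^ 'm \<Rightarrow> nat" and q where T: "simple_function borel T" and q: "\<And>s. (f s, g s) = q (T s)"
    by (rule simple_function_code) auto
  have eqs: "f = (\<lambda>s. fst (q (T s)))" "g = (\<lambda>s. snd (q (T s)))"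
    using q[symmetric] by auto
  have "(\<lambda>s. f s - g s) = (\<lambda>s. fst (q (T s)) - snd (q (T s)))"
    using q[symmetric] by (simp add: fun_eq_iff)
  note coded = simple_levy_integral_coded[OF T A levy_simple_diff[OF f g] this]
    simple_levy_integral_coded[OF T A f eqs(1)] simple_levy_integral_coded[OF T A g eqs(2)]
  from coded show ?thesis
    by eventually_elim (simp add: sum_subtractf matrix_vector_mult_diff_rdistrib)
qed

lemma simple_levy_integral_split:
  fixes f :: "real ^ 'm \<Rightarrow> real ^ 'd ^ 'n"
  assumes f: "levy_simple f" and A: "A \<in> sets borel"
  shows "AE \<omega> in P. simple_levy_integral L f UNIV \<omega>
    = simple_levy_integral L f A \<omega> + simple_levy_integral L f (- A) \<omega>"
proof -
  have "AE \<omega> in P. \<forall>y\<in>range f - {0}. L (f -` {y}) \<omega> = L (A \<inter> f -` {y}) \<omega> + L (- A \<inter> f -` {y}) \<omega>"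
  proof (rule AE_finite_allI)
    show "AE \<omega> in P. L (f -` {y}) \<omega> = L (A \<inter> f -` {y}) \<omega> + L (- A \<inter> f -` {y}) \<omega>"
      if "y \<in> range f - {0}" for y
    proof -
      define B where "B i = (if i = 0 then A else - A) \<inter> f -` {y}" for i :: nat
      have "AE \<omega> in P. L (\<Union>i\<in>{0, 1}. B i) \<omega> = (\<Sum>i\<in>{0, 1}. L (B i) \<omega>)"
      proof (rule finitely_additive)
        show "disjoint_family_on B {0, 1}" by (auto simp: disjoint_family_on_def B_def)
        show "bounded_borel (B i)" for i
          using that A unfolding B_def by (intro levy_simple_vimage[OF f]) auto
      qed simp
      moreover have "(\<Union>i\<in>{0, 1}. B i) = f -` {y}" by (auto simp: B_def)
      ultimately show ?thesis by (simp add: B_def)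
    qed
  qed (use finite_range_levy_simple[OF f] in simp)
  then show ?thesis
    by eventually_elim (simp add: simple_levy_integral_def matrix_vector_right_distrib sum.distrib[symmetric])
qed

end

context l2_levy_basis
begin

lemma inner_L_second_moment:
  assumes "bounded_borel B"
  shows "integrable P (\<lambda>\<omega>. (u \<bullet> L B \<omega>)\<^sup>2)"
    and "expectation (\<lambda>\<omega>. (u \<bullet> L B \<omega>)\<^sup>2) \<le> c * (norm u)\<^sup>2 * measure lborel B"
proof -
  have [measurable]: "L B \<in> borel_measurable P" using assms by (rule random_variable)
  show int: "integrable P (\<lambda>\<omega>. (u \<bullet> L B \<omega>)\<^sup>2)"
    using second_moment[OF assms, of u]
    by (intro integrableI_bounded) (auto intro: le_less_trans[OF _ ennreal_less_top])
  have "0 \<le> c * (norm u)\<^sup>2 * measure lborel B" using c_pos by simp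
  with second_moment[OF assms, of u] show "expectation (\<lambda>\<omega>. (u \<bullet> L B \<omega>)\<^sup>2) \<le> c * (norm u)\<^sup>2 * measure lborel B"
    by (subst (asm) nn_integral_eq_integral[OF int]) auto
qed

text \<open>
  The inequality that replaces the Ito isometry. In each coordinate the integral is a sum of
  independent centred variables over the cells, so that second moments add up.
\<close>
lemma simple_levy_integral_L2_bound:
  fixes f :: "real ^ 'm \<Rightarrow> real ^ 'd ^ 'n"
  assumes f: "levy_simple f" and A: "A \<in> sets borel"
  shows "(\<integral>\<^sup>+ \<omega>. ennreal ((norm (simple_levy_integral L f A \<omega>))\<^sup>2) \<partial>P)
    \<le> ennreal c * (\<integral>\<^sup>+ s\<in>A. ennreal ((norm (f s))\<^sup>2) \<partial>lborel)"
proof -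
  have "simple_function borel f" using f by (simp add: levy_simple_def)
  then obtain T :: "real ^ 'm \<Rightarrow> nat" and q where T: "simple_function borel T" and q: "\<And>s. f s = q (T s)"
    by (rule simple_function_code) auto
  then have fq: "f = (\<lambda>s. q (T s))" by auto
  define R where "R = range T"
  have R: "finite R" using simple_functionD(1)[OF T] by (simp add: R_def)
  define Y where "Y i b \<omega> = q b $ i \<bullet> L (cell A T b) \<omega>" for i b \<omega>
  note cell = bounded_borel_cell[OF T A]
  have meas [measurable]: "L (cell A T b) \<in> borel_measurable P" for b by (rule random_variable[OF cell])
  have "indep_vars (\<lambda>_. borel) (\<lambda>b. L (cell A T b)) UNIV"
    by (rule independent[OF disjoint_family_cell cell])
  then have ind: "indep_vars (\<lambda>_. borel) (Y i) R" for i
    unfolding Y_def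
    by (intro indep_vars_compose2[where Y="\<lambda>b x. q b $ i \<bullet> x" and X="\<lambda>b. L (cell A T b)"])
       (auto intro: indep_vars_subset)
  have Y: "integrable P (\<lambda>\<omega>. (Y i b \<omega>)\<^sup>2)" "expectation (Y i b) = 0"
    "expectation (\<lambda>\<omega>. (Y i b \<omega>)\<^sup>2) \<le> c * (norm (q b $ i))\<^sup>2 * measure lborel (cell A T b)" for i b
    unfolding Y_def by (rule inner_L_second_moment[OF cell] mean_zero[OF cell])+
  note sums = second_moment_sum_indep[OF R ind Y(1,2)]
  have norm_eq: "(norm (\<Sum>b\<in>R. q b *v L (cell A T b) \<omega>))\<^sup>2 = (\<Sum>i\<in>UNIV. (\<Sum>b\<in>R. Y i b \<omega>)\<^sup>2)" for \<omega>
    by (simp add: norm_vec_sq Y_def matrix_vector_mul_component)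
  have "(\<integral>\<^sup>+ \<omega>. ennreal ((norm (simple_levy_integral L f A \<omega>))\<^sup>2) \<partial>P)
      = (\<integral>\<^sup>+ \<omega>. ennreal (\<Sum>i\<in>UNIV. (\<Sum>b\<in>R. Y i b \<omega>)\<^sup>2) \<partial>P)"
    using simple_levy_integral_coded[OF T A f fq]
    by (intro nn_integral_cong_AE) (auto elim!: eventually_mono simp: norm_eq[unfolded R_def] R_def)
  also have "\<dots> = ennreal (expectation (\<lambda>\<omega>. \<Sum>i\<in>UNIV. (\<Sum>b\<in>R. Y i b \<omega>)\<^sup>2))"
    using sums(1) by (intro nn_integral_eq_integral) (auto intro!: AE_I2 sum_nonneg)
  also have "expectation (\<lambda>\<omega>. \<Sum>i\<in>UNIV. (\<Sum>b\<in>R. Y i b \<omega>)\<^sup>2) = (\<Sum>i\<in>UNIV. \<Sum>b\<in>R. expectation (\<lambda>\<omega>. (Y i b \<omega>)\<^sup>2))"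
    using sums by (subst Bochner_Integration.integral_sum) auto
  also have "\<dots> \<le> (\<Sum>i\<in>UNIV. \<Sum>b\<in>R. c * (norm (q b $ i))\<^sup>2 * measure lborel (cell A T b))"
    by (intro sum_mono Y)
  also have "\<dots> = (\<Sum>b\<in>R. c * (norm (q b))\<^sup>2 * measure lborel (cell A T b))"
    by (subst sum.swap) (simp add: norm_vec_sq sum_distrib_left sum_distrib_right)
  also have "ennreal \<dots> = ennreal c * (\<Sum>b\<in>R. ennreal ((norm (q b))\<^sup>2) * emeasure lborel (cell A T b))"
  proof -
    have "emeasure lborel (cell A T b) = ennreal (measure lborel (cell A T b))" for b
      using emeasure_bounded_finite[of "cell A T b"] cell[of b] by (intro emeasure_eq_ennreal_measure) auto
    then show ?thesis using c_pos
      by (simp add: sum_ennreal[symmetric] ennreal_mult sum_distrib_left mult.assoc sum_nonneg)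
  qed
  also have "(\<Sum>b\<in>R. ennreal ((norm (q b))\<^sup>2) * emeasure lborel (cell A T b))
      = (\<integral>\<^sup>+ s. (\<Sum>b\<in>R. ennreal ((norm (q b))\<^sup>2) * indicator (cell A T b) s) \<partial>lborel)"
  proof -
    have [measurable]: "cell A T b \<in> sets borel" for b using cell by simp
    show ?thesis by (subst nn_integral_sum) (auto simp: nn_integral_cmult_indicator)
  qed
  also have "\<dots> \<le> (\<integral>\<^sup>+ s\<in>A. ennreal ((norm (f s))\<^sup>2) \<partial>lborel)"
  proof (rule nn_integral_mono)
    fix s :: "real ^ 'm"
    have "(\<Sum>b\<in>R. ennreal ((norm (q b))\<^sup>2) * indicator (cell A T b) s)
        \<le> (\<Sum>b\<in>R. if b = T s then ennreal ((norm (q b))\<^sup>2) * indicator A s else 0)"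
      by (intro sum_mono) (auto simp: cell_def indicator_def)
    also have "\<dots> = ennreal ((norm (f s))\<^sup>2) * indicator A s"
      using R by (simp add: q R_def)
    finally show "(\<Sum>b\<in>R. ennreal ((norm (q b))\<^sup>2) * indicator (cell A T b) s)
        \<le> ennreal ((norm (f s))\<^sup>2) * indicator A s" .
  qed
  finally show ?thesis by (simp add: mult_left_mono ennreal_leI)
qed

end

section \<open>Convergence in probability\<close>

context prob_space
begin

lemma tendsto_in_prob_subseq:
  assumes "tendsto_in_prob M Y Z" "strict_mono r"
  shows "tendsto_in_prob M (\<lambda>k. Y (r k)) Z"
  unfolding tendsto_in_prob_def
proof (intro conjI allI impI)
  fix \<epsilon> :: real assume "\<epsilon> > 0"
  with assms(1) have "(\<lambda>k. prob {\<omega> \<in> space M. norm (Y k \<omega> - Z \<omega>) > \<epsilon>}) \<longlonglongrightarrow> 0"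
    by (simp add: tendsto_in_prob_def)
  from LIMSEQ_subseq_LIMSEQ[OF this assms(2)]
  show "(\<lambda>k. prob {\<omega> \<in> space M. norm (Y (r k) \<omega> - Z \<omega>) > \<epsilon>}) \<longlonglongrightarrow> 0"
    by (simp add: o_def)
qed (use assms in \<open>auto simp: tendsto_in_prob_def\<close>)

lemma tendsto_in_prob_cong_AE:
  assumes Y: "tendsto_in_prob M Y Z"
    and [measurable]: "\<And>k. Y' k \<in> borel_measurable M"
    and eq: "\<And>k. AE \<omega> in M. Y k \<omega> = Y' k \<omega>"
  shows "tendsto_in_prob M Y' Z"
proof -
  have [measurable]: "Y k \<in> borel_measurable M" "Z \<in> borel_measurable M" for k
    using Y by (auto simp: tendsto_in_prob_def)
  have "prob {\<omega> \<in> space M. norm (Y' k \<omega> - Z \<omega>) > \<epsilon>} = prob {\<omega> \<in> space M. norm (Y k \<omega> - Z \<omega>) > \<epsilon>}" for k \<epsilon>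
    using eq[of k] by (intro finite_measure_eq_AE) (auto elim!: eventually_mono)
  with Y show ?thesis by (simp add: tendsto_in_prob_def)
qed

lemma tendsto_in_prob_diff:
  fixes Z Z' :: "'a \<Rightarrow> real ^ 'n"
  assumes Y: "tendsto_in_prob M Y Z" and Y': "tendsto_in_prob M Y' Z'"
  shows "tendsto_in_prob M (\<lambda>k \<omega>. Y k \<omega> - Y' k \<omega>) (\<lambda>\<omega>. Z \<omega> - Z' \<omega>)"
proof -
  have [measurable]: "Y k \<in> borel_measurable M" "Y' k \<in> borel_measurable M"
    "Z \<in> borel_measurable M" "Z' \<in> borel_measurable M" for k
    using assms by (auto simp: tendsto_in_prob_def)
  have "(\<lambda>k. prob {\<omega> \<in> space M. norm ((Y k \<omega> - Y' k \<omega>) - (Z \<omega> - Z' \<omega>)) > \<epsilon>}) \<longlonglongrightarrow> 0"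
    if "\<epsilon> > 0" for \<epsilon>
  proof (rule tendsto_sandwich[where f="\<lambda>_. 0"])
    let ?A = "\<lambda>k. {\<omega> \<in> space M. norm (Y k \<omega> - Z \<omega>) > \<epsilon> / 2}"
    let ?B = "\<lambda>k. {\<omega> \<in> space M. norm (Y' k \<omega> - Z' \<omega>) > \<epsilon> / 2}"
    have "prob {\<omega> \<in> space M. norm ((Y k \<omega> - Y' k \<omega>) - (Z \<omega> - Z' \<omega>)) > \<epsilon>} \<le> prob (?A k \<union> ?B k)" for k
    proof (rule finite_measure_mono)
      show "{\<omega> \<in> space M. norm ((Y k \<omega> - Y' k \<omega>) - (Z \<omega> - Z' \<omega>)) > \<epsilon>} \<subseteq> ?A k \<union> ?B k"
      proof
        fix \<omega> assume "\<omega> \<in> {\<omega> \<in> space M. norm ((Y k \<omega> - Y' k \<omega>) - (Z \<omega> - Z' \<omega>)) > \<epsilon>}"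
        moreover have "norm ((Y k \<omega> - Y' k \<omega>) - (Z \<omega> - Z' \<omega>)) \<le> norm (Y k \<omega> - Z \<omega>) + norm (Y' k \<omega> - Z' \<omega>)"
          using norm_triangle_ineq4[of "Y k \<omega> - Z \<omega>" "Y' k \<omega> - Z' \<omega>"] by (simp add: algebra_simps)
        ultimately show "\<omega> \<in> ?A k \<union> ?B k" by auto
      qed
    qed measurable
    also have "prob (?A k \<union> ?B k) \<le> prob (?A k) + prob (?B k)" for k
      by (rule measure_Un_le) measurable
    finally show "\<forall>\<^sub>F k in sequentially. prob {\<omega> \<in> space M. norm ((Y k \<omega> - Y' k \<omega>) - (Z \<omega> - Z' \<omega>)) > \<epsilon>}
        \<le> prob (?A k) + prob (?B k)"
      by (intro always_eventually allI)
    have "(\<lambda>k. prob (?A k)) \<longlonglongrightarrow> 0" "(\<lambda>k. prob (?B k)) \<longlonglongrightarrow> 0"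
      using assms half_gt_zero[OF that] unfolding tendsto_in_prob_def by blast+
    then show "(\<lambda>k. prob (?A k) + prob (?B k)) \<longlonglongrightarrow> 0" using tendsto_add by fastforce
  qed auto
  then show ?thesis unfolding tendsto_in_prob_def by auto
qed

lemma tendsto_in_prob_unique_AE:
  fixes Z Z' :: "'a \<Rightarrow> real ^ 'n"
  assumes Y: "tendsto_in_prob M Y Z" and Y': "tendsto_in_prob M Y' Z'"
    and eq: "\<And>k. AE \<omega> in M. Y k \<omega> = Y' k \<omega>"
  shows "AE \<omega> in M. Z \<omega> = Z' \<omega>"
proof -
  note diff = tendsto_in_prob_diff[OF Y Y']
  have [measurable]: "Y k \<in> borel_measurable M" "Y' k \<in> borel_measurable M"
    "Z \<in> borel_measurable M" "Z' \<in> borel_measurable M" for k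
    using assms by (auto simp: tendsto_in_prob_def)
  have "AE \<omega> in M. norm (Z \<omega> - Z' \<omega>) \<le> \<epsilon>" if "\<epsilon> > 0" for \<epsilon>
  proof -
    have same: "prob {\<omega> \<in> space M. norm ((Y k \<omega> - Y' k \<omega>) - (Z \<omega> - Z' \<omega>)) > \<epsilon>}
        = prob {\<omega> \<in> space M. norm (Z \<omega> - Z' \<omega>) > \<epsilon>}" for k
      using eq[of k] by (intro finite_measure_eq_AE) (auto elim!: eventually_mono simp: norm_minus_commute)
    have "(\<lambda>k. prob {\<omega> \<in> space M. norm ((Y k \<omega> - Y' k \<omega>) - (Z \<omega> - Z' \<omega>)) > \<epsilon>}) \<longlonglongrightarrow> 0"
      using diff that unfolding tendsto_in_prob_def by blast
    then have "(\<lambda>k::nat. prob {\<omega> \<in> space M. norm (Z \<omega> - Z' \<omega>) > \<epsilon>}) \<longlonglongrightarrow> 0"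
      unfolding same .
    then have "prob {\<omega> \<in> space M. norm (Z \<omega> - Z' \<omega>) > \<epsilon>} = 0" by (simp add: LIMSEQ_const_iff)
    then have "AE \<omega> in M. \<not> norm (Z \<omega> - Z' \<omega>) > \<epsilon>"
      by (subst (asm) prob_eq_0) (auto elim!: eventually_mono)
    then show ?thesis by (simp add: not_less)
  qed
  then have "AE \<omega> in M. \<forall>n. norm (Z \<omega> - Z' \<omega>) \<le> inverse (real (Suc n))"
    unfolding AE_all_countable by simp
  then show ?thesis
  proof eventually_elim
    case (elim \<omega>)
    have "norm (Z \<omega> - Z' \<omega>) \<le> 0"
      by (rule LIMSEQ_le_const[OF LIMSEQ_inverse_real_of_nat]) (use elim in auto)
    then show ?case by simp
  qed
qed

text \<open>
  Chebyshev's inequality.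
\<close>
lemma tendsto_in_prob_L2_zero:
  fixes Y :: "nat \<Rightarrow> 'a \<Rightarrow> real ^ 'n"
  assumes [measurable]: "\<And>k. Y k \<in> borel_measurable M"
    and lim: "(\<lambda>k. \<integral>\<^sup>+ \<omega>. ennreal ((norm (Y k \<omega>))\<^sup>2) \<partial>M) \<longlonglongrightarrow> 0"
  shows "tendsto_in_prob M Y (\<lambda>_. 0)"
proof -
  have "(\<lambda>k. prob {\<omega> \<in> space M. norm (Y k \<omega>) > \<epsilon>}) \<longlonglongrightarrow> 0" if "\<epsilon> > 0" for \<epsilon>
  proof -
    have "ennreal (prob {\<omega> \<in> space M. norm (Y k \<omega>) > \<epsilon>})
        \<le> ennreal (inverse (\<epsilon>\<^sup>2)) * (\<integral>\<^sup>+ \<omega>. ennreal ((norm (Y k \<omega>))\<^sup>2) \<partial>M)" for k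
    proof -
      have "ennreal (prob {\<omega> \<in> space M. norm (Y k \<omega>) > \<epsilon>})
          = (\<integral>\<^sup>+ \<omega>. indicator {\<omega> \<in> space M. norm (Y k \<omega>) > \<epsilon>} \<omega> \<partial>M)"
        by (simp add: emeasure_eq_measure)
      also have "\<dots> \<le> (\<integral>\<^sup>+ \<omega>. ennreal (inverse (\<epsilon>\<^sup>2)) * ennreal ((norm (Y k \<omega>))\<^sup>2) \<partial>M)"
      proof (rule nn_integral_mono)
        fix \<omega>
        have "1 \<le> inverse (\<epsilon>\<^sup>2) * (norm (Y k \<omega>))\<^sup>2" if "norm (Y k \<omega>) > \<epsilon>"
        proof -
          have "\<epsilon>\<^sup>2 \<le> (norm (Y k \<omega>))\<^sup>2" using that \<open>\<epsilon> > 0\<close> by (intro power_mono) auto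
          then show ?thesis using \<open>\<epsilon> > 0\<close> by (simp add: field_simps)
        qed
        then show "indicator {\<omega> \<in> space M. norm (Y k \<omega>) > \<epsilon>} \<omega>
            \<le> ennreal (inverse (\<epsilon>\<^sup>2)) * ennreal ((norm (Y k \<omega>))\<^sup>2)"
          by (cases "norm (Y k \<omega>) > \<epsilon>")
             (simp_all only: indicator_def mem_Collect_eq simp_thms ennreal_mult''[symmetric] zero_le_power2
               inverse_nonnegative_iff_nonnegative of_bool_def if_True if_False split: if_split, auto)
      qed
      also have "\<dots> = ennreal (inverse (\<epsilon>\<^sup>2)) * (\<integral>\<^sup>+ \<omega>. ennreal ((norm (Y k \<omega>))\<^sup>2) \<partial>M)"
        by (rule nn_integral_cmult) measurable
      finally show ?thesis .
    qed
    note markov = this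
    have lim': "(\<lambda>k. ennreal (inverse (\<epsilon>\<^sup>2)) * (\<integral>\<^sup>+ \<omega>. ennreal ((norm (Y k \<omega>))\<^sup>2) \<partial>M)) \<longlonglongrightarrow> 0"
      using tendsto_mult_ennreal[OF tendsto_const[of "ennreal (inverse (\<epsilon>\<^sup>2))"] lim] by simp
    have "(\<lambda>k. ennreal (prob {\<omega> \<in> space M. norm (Y k \<omega>) > \<epsilon>})) \<longlonglongrightarrow> 0"
      by (rule tendsto_sandwich[OF _ _ tendsto_const lim']) (intro always_eventually allI markov zero_le)+
    then show ?thesis by (simp add: ennreal_0[symmetric] del: ennreal_0)
  qed
  then show ?thesis by (simp add: tendsto_in_prob_def)
qed

lemma tendsto_in_prob_AE:
  fixes Y :: "nat \<Rightarrow> 'a \<Rightarrow> real ^ 'n"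
  assumes [measurable]: "\<And>k. Y k \<in> borel_measurable M" "Z \<in> borel_measurable M"
    and lim: "AE \<omega> in M. (\<lambda>k. Y k \<omega>) \<longlonglongrightarrow> Z \<omega>"
  shows "tendsto_in_prob M Y Z"
proof -
  have "(\<lambda>k. prob {\<omega> \<in> space M. norm (Y k \<omega> - Z \<omega>) > \<epsilon>}) \<longlonglongrightarrow> 0" if "\<epsilon> > 0" for \<epsilon>
  proof -
    let ?A = "\<lambda>k. {\<omega> \<in> space M. norm (Y k \<omega> - Z \<omega>) > \<epsilon>}"
    have "(\<lambda>k. LINT \<omega>|M. indicator (?A k) \<omega> :: real) \<longlonglongrightarrow> (LINT \<omega>|M. 0)"
    proof (rule integral_dominated_convergence[where w="\<lambda>_. 1"])
      show "AE \<omega> in M. (\<lambda>k. indicator (?A k) \<omega> :: real) \<longlonglongrightarrow> 0"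
        using lim
      proof eventually_elim
        case (elim \<omega>)
        have "(\<lambda>k. norm (Y k \<omega> - Z \<omega>)) \<longlonglongrightarrow> 0" using elim by (simp add: LIM_zero tendsto_norm_zero)
        from order_tendstoD(2)[OF this that]
        have "\<forall>\<^sub>F k in sequentially. indicator (?A k) \<omega> = (0 :: real)"
          by (auto elim!: eventually_mono)
        then show ?case by (rule tendsto_eventually)
      qed
    qed auto
    then show ?thesis by simp
  qed
  then show ?thesis by (simp add: tendsto_in_prob_def)
qed

end

section \<open>Uniqueness of the stochastic integral\<close>

lemma levy_simple_L2:
  fixes f :: "real ^ 'm \<Rightarrow> real ^ 'd ^ 'n"
  assumes "levy_simple f"
  shows "(\<integral>\<^sup>+ s. ennreal ((norm (f s))\<^sup>2) \<partial>lborel) < \<infinity>"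
proof -
  have "finite ((\<lambda>s. (norm (f s))\<^sup>2) ` UNIV)"
    using finite_imageI[OF finite_range_levy_simple[OF assms], of "\<lambda>y. (norm y)\<^sup>2"] by (simp add: image_image)
  then obtain K where K: "\<And>s. (norm (f s))\<^sup>2 \<le> K"
    by (metis bdd_above.E bdd_above_finite rangeI)
  define S where "S = {s. f s \<noteq> 0}"
  have [measurable]: "f \<in> borel_measurable borel" using assms by (rule levy_simple_measurable)
  have [measurable]: "S \<in> sets borel" unfolding S_def by measurable
  have "bounded S" using assms by (simp add: levy_simple_def S_def)
  have "(\<integral>\<^sup>+ s. ennreal ((norm (f s))\<^sup>2) \<partial>lborel) \<le> (\<integral>\<^sup>+ s. ennreal K * indicator S s \<partial>lborel)"
    by (intro nn_integral_mono) (auto simp: indicator_def S_def K ennreal_leI)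
  also have "\<dots> = ennreal K * emeasure lborel S"
    by (simp add: nn_integral_cmult_indicator)
  also have "\<dots> < \<infinity>"
    using emeasure_bounded_finite[OF \<open>bounded S\<close>] by (auto simp: ennreal_mult_less_top)
  finally show ?thesis .
qed

lemma norm_add_sq_le: "(norm (x + y :: 'a :: real_normed_vector))\<^sup>2 \<le> 2 * (norm x)\<^sup>2 + 2 * (norm y)\<^sup>2"
proof -
  have "(norm (x + y))\<^sup>2 \<le> (norm x + norm y)\<^sup>2"
    by (intro power_mono norm_triangle_ineq) simp
  also have "\<dots> \<le> 2 * (norm x)\<^sup>2 + 2 * (norm y)\<^sup>2"
    using zero_le_power2[of "norm x - norm y"] by (simp add: power2_sum power2_diff)
  finally show ?thesis .
qed

context l2_levy_basis
begin

text \<open>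
  The integral does not depend on the approximating simple functions. Convergence of the integrals
  over a single set would not give this: the mass of \<open>H k\<close> may escape to ever smaller sets while
  the integrals keep a non-zero limit. Convergence over every Borel set excludes it by a gliding
  hump. Up to a null set the space is exhausted by sets \<open>E j\<close> on which the sequence is uniformly
  bounded. On each \<open>E j\<close> the integrals of \<open>H k\<close> tend to 0 in \<open>L\<^sup>2\<close>, and for fixed \<open>k\<close> so do the
  integrals of \<open>H k\<close> over the complements of the \<open>E j\<close>. Hence along a suitable subsequence
  the \<open>i\<close>-th function essentially lives on one shell \<open>E (J (Suc i)) - E (J i)\<close> only. Let \<open>B\<close> be the
  union of the even shells. The integrals of the odd members of the subsequence over \<open>B\<close> tend to 0,
  and so do the integrals of the even members over the complement of \<open>B\<close>; since the limits over
  both sets exist, both are 0.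
\<close>
lemma limit_of_null_sequence:
  fixes H :: "nat \<Rightarrow> real ^ 'm \<Rightarrow> real ^ 'd ^ 'n"
  assumes simple: "\<And>k. levy_simple (H k)"
    and null: "AE s in lborel. (\<lambda>k. H k s) \<longlonglongrightarrow> 0"
    and conv: "\<And>B. B \<in> sets borel \<Longrightarrow> \<exists>Z. tendsto_in_prob P (\<lambda>k. simple_levy_integral L (H k) B) Z"
    and lim: "tendsto_in_prob P (\<lambda>k. simple_levy_integral L (H k) UNIV) Z"
  shows "AE \<omega> in P. Z \<omega> = 0"
proof -
  have [measurable]: "H k \<in> borel_measurable borel" for k using simple by (rule levy_simple_measurable)
  define q where "q k A = (\<integral>\<^sup>+ s\<in>A. ennreal ((norm (H k s))\<^sup>2) \<partial>lborel)" for k A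
  define E where "E j = {s. norm s \<le> real j \<and> (\<forall>k. norm (H k s) \<le> real j)}" for j
  have [measurable]: "E j \<in> sets borel" for j unfolding E_def by measurable
  have E_mono: "E i \<subseteq> E j" if "i \<le> j" for i j
    using that by (fastforce simp: E_def intro: order_trans)
  have q_core: "(\<lambda>k. q k (E j)) \<longlonglongrightarrow> 0" for j
  proof -
    have [measurable]: "cball (0 :: real ^ 'm) (real j) \<in> sets borel" by simp
    have "(\<lambda>k. q k (E j)) \<longlonglongrightarrow> (\<integral>\<^sup>+ s. 0 \<partial>(lborel :: (real ^ 'm) measure))"
      unfolding q_def
    proof (rule nn_integral_dominated_convergence[where w="\<lambda>s. ennreal ((real j)\<^sup>2) * indicator (cball 0 (real j)) s"])
      show "AE s in lborel. ennreal ((norm (H k s))\<^sup>2) * indicator (E j) s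
          \<le> ennreal ((real j)\<^sup>2) * indicator (cball 0 (real j)) s" for k
        by (intro AE_I2) (auto simp: indicator_def E_def intro!: ennreal_leI power_mono)
      have "emeasure lborel (cball (0 :: real ^ 'm) (real j)) < \<infinity>" by (rule emeasure_bounded_finite) simp
      then show "(\<integral>\<^sup>+ s. ennreal ((real j)\<^sup>2) * indicator (cball (0 :: real ^ 'm) (real j)) s \<partial>lborel) < \<infinity>"
        by (simp add: nn_integral_cmult_indicator ennreal_mult_less_top)
      show "AE s in lborel. (\<lambda>k. ennreal ((norm (H k s))\<^sup>2) * indicator (E j) s) \<longlonglongrightarrow> 0"
        using null
      proof eventually_elim
        case (elim s)
        have "(\<lambda>k. ennreal ((norm (H k s))\<^sup>2)) \<longlonglongrightarrow> ennreal ((norm (0 :: real ^ 'd ^ 'n))\<^sup>2)"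
          by (intro tendsto_intros elim)
        then show ?case by (cases "s \<in> E j") auto
      qed
    qed auto
    then show ?thesis by simp
  qed
  have q_rest: "(\<lambda>j. q k (- E j)) \<longlonglongrightarrow> 0" for k
  proof -
    have "(\<lambda>j. q k (- E j)) \<longlonglongrightarrow> (\<integral>\<^sup>+ s. 0 \<partial>(lborel :: (real ^ 'm) measure))"
      unfolding q_def
    proof (rule nn_integral_dominated_convergence[where w="\<lambda>s. ennreal ((norm (H k s))\<^sup>2)"])
      show "AE s in lborel. ennreal ((norm (H k s))\<^sup>2) * indicator (- E j) s \<le> ennreal ((norm (H k s))\<^sup>2)" for j
        by (intro AE_I2) (auto simp: indicator_def)
      show "(\<integral>\<^sup>+ s. ennreal ((norm (H k s))\<^sup>2) \<partial>lborel) < \<infinity>" by (rule levy_simple_L2[OF simple])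
      show "AE s in lborel. (\<lambda>j. ennreal ((norm (H k s))\<^sup>2) * indicator (- E j) s) \<longlonglongrightarrow> 0"
        using null
      proof eventually_elim
        case (elim s)
        then have "Bseq (\<lambda>k. H k s)" by (intro convergent_imp_Bseq convergentI)
        then obtain K where K: "\<And>k. norm (H k s) \<le> K" by (auto simp: Bseq_def)
        obtain J where J: "max (norm s) K \<le> real J" using real_arch_simple by blast
        have "s \<in> E j" if "j \<ge> J" for j
        proof -
          have "s \<in> E J" using J K by (auto simp: E_def intro: order_trans)
          then show ?thesis using E_mono[OF that] by auto
        qed
        then have "\<forall>\<^sub>F j in sequentially. ennreal ((norm (H k s))\<^sup>2) * indicator (- E j) s = 0"
          unfolding eventually_sequentially by (intro exI[of _ J]) auto
        then show ?case by (rule tendsto_eventually)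
      qed
    qed auto
    then show ?thesis by simp
  qed
  have choose: "\<exists>k>K. \<exists>j'>j. q k (E j) \<le> ennreal (inverse (real (Suc i))) \<and> q k (- E j') \<le> ennreal (inverse (real (Suc i)))"
    for K j i
  proof -
    have pos: "0 < ennreal (inverse (real (Suc i)))" by simp
    from order_tendstoD(2)[OF q_core[of j] pos] obtain k0 where
      k0: "\<And>k. k \<ge> k0 \<Longrightarrow> q k (E j) < ennreal (inverse (real (Suc i)))"
      unfolding eventually_sequentially by auto
    define k where "k = max k0 (Suc K)"
    from order_tendstoD(2)[OF q_rest[of k] pos] obtain j0 where
      j0: "\<And>j. j \<ge> j0 \<Longrightarrow> q k (- E j) < ennreal (inverse (real (Suc i)))"
      unfolding eventually_sequentially by auto
    have "K < k" "j < max j0 (Suc j)" by (auto simp: k_def)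
    moreover have "q k (E j) \<le> ennreal (inverse (real (Suc i)))"
      by (rule less_imp_le, rule k0) (simp add: k_def)
    moreover have "q k (- E (max j0 (Suc j))) \<le> ennreal (inverse (real (Suc i)))"
      by (rule less_imp_le, rule j0) simp
    ultimately show ?thesis by blast
  qed
  \<comment> \<open>A state \<open>(k, j, j')\<close> consists of the index of a function and of the two ends of its shell;
    consecutive shells share an end.\<close>
  define good where "good i x \<longleftrightarrow> (case x of (k, j, j') \<Rightarrow> j < j' \<and>
    q k (E j) \<le> ennreal (inverse (real (Suc i))) \<and> q k (- E j') \<le> ennreal (inverse (real (Suc i))))" for i x
  have "\<exists>f. \<forall>i. good i (f i) \<and> fst (f i) < fst (f (Suc i)) \<and> fst (snd (f (Suc i))) = snd (snd (f i))"
  proof (rule dependent_nat_choice)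
    show "\<exists>x. good 0 x" using choose[of 0 0 0] by (auto simp: good_def)
    show "\<exists>y. good (Suc i) y \<and> fst x < fst y \<and> fst (snd y) = snd (snd x)" for x i
    proof -
      obtain k j' where "k > fst x" "j' > snd (snd x)" "q k (E (snd (snd x))) \<le> ennreal (inverse (real (Suc (Suc i))))"
        "q k (- E j') \<le> ennreal (inverse (real (Suc (Suc i))))"
        using choose by blast
      then show ?thesis
        by (intro exI[of _ "(k, snd (snd x), j')"]) (auto simp: good_def)
    qed
  qed
  then obtain f where f: "\<And>i. good i (f i)" "\<And>i. fst (f i) < fst (f (Suc i))"
    "\<And>i. fst (snd (f (Suc i))) = snd (snd (f i))" by blast
  define r where "r i = fst (f i)" for i
  define J where "J i = fst (snd (f i))" for i
  have r: "strict_mono r" using f(2) by (simp add: r_def strict_mono_Suc_iff)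
  have J': "J i < J (Suc i)"
    "q (r i) (E (J i)) \<le> ennreal (inverse (real (Suc i)))"
    "q (r i) (- E (J (Suc i))) \<le> ennreal (inverse (real (Suc i)))" for i
    using f(1)[of i] f(3)[of i] by (auto simp: good_def r_def J_def split: prod.splits)
  have "strict_mono J" using J'(1) by (simp add: strict_mono_Suc_iff)
  then have EJ_mono: "E (J a) \<subseteq> E (J b)" if "a \<le> b" for a b
    using that by (intro E_mono) (simp add: strict_mono_less_eq)
  define B where "B = (\<Union>n. E (J (Suc (2 * n))) - E (J (2 * n)))"
  have [measurable]: "B \<in> sets borel" unfolding B_def by measurable
  \<comment> \<open>If \<open>A\<close> avoids the shells of infinitely many members, then the integral over \<open>A\<close> has limit 0.\<close>
  have zero: "AE \<omega> in P. W \<omega> = 0"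
    if A: "A \<in> sets borel" and W: "tendsto_in_prob P (\<lambda>k. simple_levy_integral L (H k) A) W"
      and p: "strict_mono p" and sub: "\<And>n. A \<subseteq> E (J (p n)) \<union> - E (J (Suc (p n)))" for A W and p :: "nat \<Rightarrow> nat"
  proof -
    have A' [measurable]: "A \<in> sets borel" by fact
    have rp: "strict_mono (\<lambda>n. r (p n))" using r p by (simp add: strict_mono_def)
    have q_le: "q (r (p n)) A \<le> ennreal (2 * inverse (real (Suc n)))" for n
    proof -
      have "q (r (p n)) A \<le> q (r (p n)) (E (J (p n))) + q (r (p n)) (- E (J (Suc (p n))))"
        unfolding q_def using sub[of n]
        by (subst nn_integral_add[symmetric], measurable)
           (intro nn_integral_mono, auto simp: indicator_def)
      also have "\<dots> \<le> ennreal (inverse (real (Suc (p n)))) + ennreal (inverse (real (Suc (p n))))"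
        by (intro add_mono J')
      also have "\<dots> = ennreal (2 * inverse (real (Suc (p n))))" by (simp flip: ennreal_plus)
      also have "\<dots> \<le> ennreal (2 * inverse (real (Suc n)))"
        using seq_suble[OF p, of n] by (intro ennreal_leI mult_left_mono le_imp_inverse_le) auto
      finally show ?thesis .
    qed
    have "tendsto_in_prob P (\<lambda>n. simple_levy_integral L (H (r (p n))) A) (\<lambda>_. 0)"
    proof (rule tendsto_in_prob_L2_zero)
      show "simple_levy_integral L (H (r (p n))) A \<in> borel_measurable P" for n
        by (rule simple_levy_integral_measurable[OF simple A])
      have bound: "(\<integral>\<^sup>+ \<omega>. ennreal ((norm (simple_levy_integral L (H (r (p n))) A \<omega>))\<^sup>2) \<partial>P)
          \<le> ennreal (c * (2 * inverse (real (Suc n))))" for n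
      proof -
        have "(\<integral>\<^sup>+ \<omega>. ennreal ((norm (simple_levy_integral L (H (r (p n))) A \<omega>))\<^sup>2) \<partial>P) \<le> ennreal c * q (r (p n)) A"
          unfolding q_def by (rule simple_levy_integral_L2_bound[OF simple A])
        also have "\<dots> \<le> ennreal c * ennreal (2 * inverse (real (Suc n)))" by (intro mult_left_mono q_le) simp
        also have "\<dots> = ennreal (c * (2 * inverse (real (Suc n))))" using c_pos by (intro ennreal_mult[symmetric]) auto
        finally show ?thesis .
      qed
      have "(\<lambda>n. c * (2 * inverse (real (Suc n)))) \<longlonglongrightarrow> 0" by real_asymp
      then have upper: "(\<lambda>n. ennreal (c * (2 * inverse (real (Suc n))))) \<longlonglongrightarrow> 0"
        using tendsto_ennrealI by fastforce
      show "(\<lambda>n. \<integral>\<^sup>+ \<omega>. ennreal ((norm (simple_levy_integral L (H (r (p n))) A \<omega>))\<^sup>2) \<partial>P) \<longlonglongrightarrow> 0"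
        by (rule tendsto_sandwich[OF _ _ tendsto_const upper]) (intro always_eventually allI bound zero_le)+
    qed
    then show ?thesis
      using tendsto_in_prob_unique_AE[OF tendsto_in_prob_subseq[OF W rp]] by simp
  qed
  obtain Z1 where Z1: "tendsto_in_prob P (\<lambda>k. simple_levy_integral L (H k) B) Z1" using conv[of B] by auto
  obtain Z2 where Z2: "tendsto_in_prob P (\<lambda>k. simple_levy_integral L (H k) (- B)) Z2" using conv[of "- B"] by auto
  have "AE \<omega> in P. Z1 \<omega> = 0"
  proof (rule zero[of B Z1 "\<lambda>n. Suc (2 * n)", OF _ Z1])
    show "B \<subseteq> E (J (Suc (2 * n))) \<union> - E (J (Suc (Suc (2 * n))))" for n
    proof
      fix s assume "s \<in> B"
      then obtain m where m: "s \<in> E (J (Suc (2 * m)))" "s \<notin> E (J (2 * m))" by (auto simp: B_def)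
      show "s \<in> E (J (Suc (2 * n))) \<union> - E (J (Suc (Suc (2 * n))))"
      proof (cases "m \<le> n")
        case True
        with EJ_mono[of "Suc (2 * m)" "Suc (2 * n)"] m show ?thesis by auto
      next
        case False
        with EJ_mono[of "Suc (Suc (2 * n))" "2 * m"] m show ?thesis by auto
      qed
    qed
  qed (auto simp: strict_mono_def)
  moreover have "AE \<omega> in P. Z2 \<omega> = 0"
  proof (rule zero[of "- B" Z2 "\<lambda>n. 2 * n", OF _ Z2])
    show "- B \<subseteq> E (J (2 * n)) \<union> - E (J (Suc (2 * n)))" for n by (auto simp: B_def)
  qed (auto simp: strict_mono_def)
  moreover have "AE \<omega> in P. Z \<omega> - Z1 \<omega> = Z2 \<omega>"
  proof (rule tendsto_in_prob_unique_AE[OF tendsto_in_prob_diff[OF lim Z1] Z2])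
    show "AE \<omega> in P. simple_levy_integral L (H k) UNIV \<omega> - simple_levy_integral L (H k) B \<omega>
        = simple_levy_integral L (H k) (- B) \<omega>" for k
      using simple_levy_integral_split[OF simple[of k], of B] by (auto elim!: eventually_mono)
  qed
  ultimately show ?thesis by eventually_elim simp
qed

end

section \<open>Integrals of square-integrable kernels\<close>

text \<open>
  The geometric rate is what turns \<open>L\<^sup>2\<close> convergence of the integrals into almost sure convergence.
\<close>
lemma L2_approx_levy_simple:
  fixes f :: "real ^ 'm \<Rightarrow> real ^ 'd ^ 'n"
  assumes [measurable]: "f \<in> borel_measurable borel"
    and f2: "(\<integral>\<^sup>+ s. ennreal ((norm (f s))\<^sup>2) \<partial>lborel) < \<infinity>"
  obtains G :: "nat \<Rightarrow> real ^ 'm \<Rightarrow> real ^ 'd ^ 'n"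
  where "\<And>k. levy_simple (G k)" "\<And>s. (\<lambda>k. G k s) \<longlonglongrightarrow> f s"
    "\<And>k. (\<integral>\<^sup>+ s. ennreal ((norm (G k s - f s))\<^sup>2) \<partial>lborel) \<le> ennreal ((1 / 4) ^ k)"
proof -
  obtain S where S: "\<And>k. simple_function borel (S k)" "\<And>s. (\<lambda>k. S k s) \<longlonglongrightarrow> f s"
    "\<And>k s. norm (S k s) \<le> 2 * norm (f s)"
    using borel_measurable_implies_sequence_metric[of f borel 0] by auto
  define F where "F k s = (indicator (ball 0 (real k)) s :: real) *\<^sub>R S k s" for k s
  have simple: "levy_simple (F k)" for k
    unfolding levy_simple_def
  proof
    have "simple_function borel (indicator (ball (0 :: real ^ 'm) (real k)) :: _ \<Rightarrow> real)"
      by (rule simple_function_indicator) simp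
    then show "simple_function borel (F k)"
      unfolding F_def by (rule simple_function_compose2[OF _ S(1)])
    show "bounded {s. F k s \<noteq> 0}"
      by (rule bounded_subset[of "ball 0 (real k)"]) (auto simp: F_def indicator_def)
  qed
  then have [measurable]: "F k \<in> borel_measurable borel" for k by (rule levy_simple_measurable)
  have F_lim: "(\<lambda>k. F k s) \<longlonglongrightarrow> f s" for s
  proof -
    obtain N where N: "norm s < real N" using reals_Archimedean2 by blast
    have "\<forall>\<^sub>F k in sequentially. S k s = F k s"
      unfolding eventually_sequentially
      by (rule exI[of _ N]) (use N in \<open>auto simp: F_def indicator_def\<close>)
    then show ?thesis using S(2) by (rule Lim_transform_eventually[rotated])
  qed
  have "(\<lambda>k. \<integral>\<^sup>+ s. ennreal ((norm (F k s - f s))\<^sup>2) \<partial>lborel) \<longlonglongrightarrow> (\<integral>\<^sup>+ s. 0 \<partial>(lborel :: (real ^ 'm) measure))"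
  proof (rule nn_integral_dominated_convergence[where w="\<lambda>s. 9 * ennreal ((norm (f s))\<^sup>2)"])
    show "AE s in lborel. ennreal ((norm (F k s - f s))\<^sup>2) \<le> 9 * ennreal ((norm (f s))\<^sup>2)" for k
    proof (intro AE_I2)
      fix s
      have "norm (F k s - f s) \<le> norm (F k s) + norm (f s)" by (rule norm_triangle_ineq4)
      also have "\<dots> \<le> 3 * norm (f s)" using S(3)[of k s] by (auto simp: F_def indicator_def)
      finally have "(norm (F k s - f s))\<^sup>2 \<le> (3 * norm (f s))\<^sup>2" by (intro power_mono) auto
      then show "ennreal ((norm (F k s - f s))\<^sup>2) \<le> 9 * ennreal ((norm (f s))\<^sup>2)"
        by (simp add: power_mult_distrib ennreal_leI ennreal_mult''[symmetric] flip: ennreal_numeral)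
    qed
    show "(\<integral>\<^sup>+ s. 9 * ennreal ((norm (f s))\<^sup>2) \<partial>lborel) < \<infinity>"
      using f2 by (simp add: nn_integral_cmult ennreal_mult_less_top)
    show "AE s in lborel. (\<lambda>k. ennreal ((norm (F k s - f s))\<^sup>2)) \<longlonglongrightarrow> 0"
    proof (intro AE_I2)
      fix s
      have "(\<lambda>k. ennreal ((norm (F k s - f s))\<^sup>2)) \<longlonglongrightarrow> ennreal ((norm (f s - f s))\<^sup>2)"
        by (intro tendsto_intros F_lim)
      then show "(\<lambda>k. ennreal ((norm (F k s - f s))\<^sup>2)) \<longlonglongrightarrow> 0" by simp
    qed
  qed auto
  then have L2: "(\<lambda>k. \<integral>\<^sup>+ s. ennreal ((norm (F k s - f s))\<^sup>2) \<partial>lborel) \<longlonglongrightarrow> 0" by simp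
  have "\<exists>n\<ge>k. (\<integral>\<^sup>+ s. ennreal ((norm (F n s - f s))\<^sup>2) \<partial>lborel) \<le> ennreal ((1 / 4) ^ k)" for k
  proof -
    have "0 < ennreal ((1 / 4) ^ k)" by simp
    from order_tendstoD(2)[OF L2 this] obtain N where
      "\<And>n. n \<ge> N \<Longrightarrow> (\<integral>\<^sup>+ s. ennreal ((norm (F n s - f s))\<^sup>2) \<partial>lborel) < ennreal ((1 / 4) ^ k)"
      unfolding eventually_sequentially by auto
    then show ?thesis by (intro exI[of _ "max N k"]) (auto intro: less_imp_le)
  qed
  then have "\<exists>r. \<forall>k. r k \<ge> k \<and> (\<integral>\<^sup>+ s. ennreal ((norm (F (r k) s - f s))\<^sup>2) \<partial>lborel) \<le> ennreal ((1 / 4) ^ k)"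
    by (intro choice allI)
  then obtain r where r: "\<And>k. r k \<ge> k"
    "\<And>k. (\<integral>\<^sup>+ s. ennreal ((norm (F (r k) s - f s))\<^sup>2) \<partial>lborel) \<le> ennreal ((1 / 4) ^ k)"
    by blast
  have "filterlim r at_top sequentially"
    by (rule filterlim_at_top_mono[OF filterlim_ident]) (auto simp: r)
  then have "(\<lambda>k. F (r k) s) \<longlonglongrightarrow> f s" for s
    by (rule filterlim_compose[OF F_lim])
  then show ?thesis by (rule that[OF simple _ r(2)])
qed

context l2_levy_basis
begin

lemma simple_levy_integral_diff_L2_bound:
  fixes f g :: "real ^ 'm \<Rightarrow> real ^ 'd ^ 'n"
  assumes f: "levy_simple f" and g: "levy_simple g" and A: "A \<in> sets borel"
  shows "(\<integral>\<^sup>+ \<omega>. ennreal ((norm (simple_levy_integral L f A \<omega> - simple_levy_integral L g A \<omega>))\<^sup>2) \<partial>P)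
    \<le> ennreal c * (\<integral>\<^sup>+ s. ennreal ((norm (f s - g s))\<^sup>2) \<partial>lborel)"
proof -
  have "(\<integral>\<^sup>+ \<omega>. ennreal ((norm (simple_levy_integral L f A \<omega> - simple_levy_integral L g A \<omega>))\<^sup>2) \<partial>P)
      = (\<integral>\<^sup>+ \<omega>. ennreal ((norm (simple_levy_integral L (\<lambda>s. f s - g s) A \<omega>))\<^sup>2) \<partial>P)"
    using simple_levy_integral_diff[OF f g A]
    by (intro nn_integral_cong_AE) (auto elim!: eventually_mono)
  also have "\<dots> \<le> ennreal c * (\<integral>\<^sup>+ s\<in>A. ennreal ((norm (f s - g s))\<^sup>2) \<partial>lborel)"
    by (rule simple_levy_integral_L2_bound[OF levy_simple_diff[OF f g] A])
  also have "\<dots> \<le> ennreal c * (\<integral>\<^sup>+ s. ennreal ((norm (f s - g s))\<^sup>2) \<partial>lborel)"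
    by (intro mult_left_mono nn_integral_mono) (auto simp: indicator_def)
  finally show ?thesis .
qed

text \<open>
  The increments of the integrals have summable first moments, so they are almost surely
  absolutely summable.
\<close>
lemma rapid_L2_approx_converges:
  fixes G :: "nat \<Rightarrow> real ^ 'm \<Rightarrow> real ^ 'd ^ 'n"
  assumes [measurable]: "f \<in> borel_measurable borel"
    and G: "\<And>k. levy_simple (G k)"
    and rapid: "\<And>k. (\<integral>\<^sup>+ s. ennreal ((norm (G k s - f s))\<^sup>2) \<partial>lborel) \<le> ennreal ((1 / 4) ^ k)"
    and B: "B \<in> sets borel"
  obtains Z where "Z \<in> borel_measurable P" "AE \<omega> in P. (\<lambda>k. simple_levy_integral L (G k) B \<omega>) \<longlonglongrightarrow> Z \<omega>"
proof
  have [measurable]: "G k \<in> borel_measurable borel" for k using G by (rule levy_simple_measurable)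
  have [measurable]: "simple_levy_integral L (G k) B \<in> borel_measurable P" for k
    by (rule simple_levy_integral_measurable[OF G B])
  define D where "D k \<omega> = simple_levy_integral L (G (Suc k)) B \<omega> - simple_levy_integral L (G k) B \<omega>" for k \<omega>
  have [measurable]: "D k \<in> borel_measurable P" for k unfolding D_def by measurable
  have D2: "(\<integral>\<^sup>+ \<omega>. ennreal ((norm (D k \<omega>))\<^sup>2) \<partial>P) \<le> ennreal (4 * c * (1 / 4) ^ k)" for k
  proof -
    have "(\<integral>\<^sup>+ s. ennreal ((norm (G (Suc k) s - G k s))\<^sup>2) \<partial>lborel)
        \<le> (\<integral>\<^sup>+ s. 2 * ennreal ((norm (G (Suc k) s - f s))\<^sup>2) + 2 * ennreal ((norm (G k s - f s))\<^sup>2) \<partial>lborel)"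
    proof (rule nn_integral_mono)
      fix s
      have "(norm (G (Suc k) s - G k s))\<^sup>2 \<le> 2 * (norm (G (Suc k) s - f s))\<^sup>2 + 2 * (norm (G k s - f s))\<^sup>2"
        using norm_add_sq_le[of "G (Suc k) s - f s" "f s - G k s"] by (simp add: norm_minus_commute)
      then show "ennreal ((norm (G (Suc k) s - G k s))\<^sup>2)
          \<le> 2 * ennreal ((norm (G (Suc k) s - f s))\<^sup>2) + 2 * ennreal ((norm (G k s - f s))\<^sup>2)"
        by (simp add: ennreal_leI ennreal_mult''[symmetric] ennreal_plus[symmetric]
              flip: ennreal_numeral del: ennreal_plus)
    qed
    also have "\<dots> = 2 * (\<integral>\<^sup>+ s. ennreal ((norm (G (Suc k) s - f s))\<^sup>2) \<partial>lborel)
        + 2 * (\<integral>\<^sup>+ s. ennreal ((norm (G k s - f s))\<^sup>2) \<partial>lborel)"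
      by (simp add: nn_integral_add nn_integral_cmult)
    also have "\<dots> \<le> 2 * ennreal ((1 / 4) ^ Suc k) + 2 * ennreal ((1 / 4) ^ k)"
      by (intro add_mono mult_left_mono rapid) auto
    also have "\<dots> = ennreal (2 * (1 / 4) ^ Suc k + 2 * (1 / 4) ^ k)"
    proof -
      have two: "2 * ennreal x = ennreal (2 * x)" for x by (subst ennreal_mult') simp_all
      show ?thesis unfolding two by (rule ennreal_plus[symmetric]) simp_all
    qed
    also have "\<dots> \<le> ennreal (4 * (1 / 4) ^ k)" by (intro ennreal_leI) simp
    finally have "ennreal c * (\<integral>\<^sup>+ s. ennreal ((norm (G (Suc k) s - G k s))\<^sup>2) \<partial>lborel)
        \<le> ennreal c * ennreal (4 * (1 / 4) ^ k)" by (rule mult_left_mono) simp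
    also have "\<dots> = ennreal (4 * c * (1 / 4) ^ k)"
      using c_pos by (subst ennreal_mult[symmetric]) (auto simp: mult_ac)
    finally show ?thesis
      unfolding D_def using simple_levy_integral_diff_L2_bound[OF G G B, of "Suc k" k] by simp
  qed
  have D1: "(\<integral>\<^sup>+ \<omega>. ennreal (norm (D k \<omega>)) \<partial>P) \<le> ennreal ((1 / 2 + 2 * c) * (1 / 2) ^ k)" for k
  proof -
    have "(\<integral>\<^sup>+ \<omega>. ennreal (norm (D k \<omega>)) \<partial>P)
        \<le> (\<integral>\<^sup>+ \<omega>. ennreal ((1 / 2) * (1 / 2) ^ k) + ennreal (2 ^ k / 2) * ennreal ((norm (D k \<omega>))\<^sup>2) \<partial>P)"
    proof (rule nn_integral_mono)
      fix \<omega>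
      \<comment> \<open>The inequality of arithmetic and geometric means, weighted so that both terms are of order \<open>(1/2) ^ k\<close> in mean.\<close>
      have "0 \<le> (1 - 2 ^ k * norm (D k \<omega>))\<^sup>2 / (2 * 2 ^ k)" by simp
      also have "\<dots> = (1 / 2) * (1 / 2) ^ k + 2 ^ k / 2 * (norm (D k \<omega>))\<^sup>2 - norm (D k \<omega>)"
        by (simp add: power2_diff power_one_over field_simps power2_eq_square)
      finally have "norm (D k \<omega>) \<le> (1 / 2) * (1 / 2) ^ k + 2 ^ k / 2 * (norm (D k \<omega>))\<^sup>2" by simp
      then show "ennreal (norm (D k \<omega>)) \<le> ennreal ((1 / 2) * (1 / 2) ^ k) + ennreal (2 ^ k / 2) * ennreal ((norm (D k \<omega>))\<^sup>2)"
        by (simp add: ennreal_leI ennreal_mult''[symmetric] ennreal_plus[symmetric] del: ennreal_plus)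
    qed
    also have "\<dots> = ennreal ((1 / 2) * (1 / 2) ^ k) + ennreal (2 ^ k / 2) * (\<integral>\<^sup>+ \<omega>. ennreal ((norm (D k \<omega>))\<^sup>2) \<partial>P)"
      by (subst nn_integral_add) (auto simp: nn_integral_cmult emeasure_space_1)
    also have "\<dots> \<le> ennreal ((1 / 2) * (1 / 2) ^ k) + ennreal (2 ^ k / 2) * ennreal (4 * c * (1 / 4) ^ k)"
      by (intro add_left_mono mult_left_mono D2) simp
    also have "\<dots> = ennreal ((1 / 2) * (1 / 2) ^ k + 2 ^ k / 2 * (4 * c * (1 / 4) ^ k))"
      using c_pos by (subst ennreal_mult[symmetric], simp, simp, subst ennreal_plus[symmetric]) auto
    also have "(1 / 2) * (1 / 2) ^ k + 2 ^ k / 2 * (4 * c * (1 / 4) ^ k) = (1 / 2 + 2 * c) * (1 / 2) ^ k"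
    proof -
      have "(2 :: real) ^ k * (1 / 4) ^ k = (1 / 2) ^ k" by (simp flip: power_mult_distrib)
      then show ?thesis by (simp add: algebra_simps)
    qed
    finally show ?thesis .
  qed
  have "(\<integral>\<^sup>+ \<omega>. (\<Sum>k. ennreal (norm (D k \<omega>))) \<partial>P) = (\<Sum>k. \<integral>\<^sup>+ \<omega>. ennreal (norm (D k \<omega>)) \<partial>P)"
    by (rule nn_integral_suminf) measurable
  also have "\<dots> \<le> (\<Sum>k. ennreal ((1 / 2 + 2 * c) * (1 / 2) ^ k))"
    by (intro suminf_le D1) auto
  also have "\<dots> < \<infinity>"
  proof -
    have "summable (\<lambda>k. (1 / 2 + 2 * c) * (1 / 2) ^ k)" by (intro summable_mult summable_geometric) simp
    then show ?thesis using c_pos by (subst suminf_ennreal2) (auto simp: less_top)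
  qed
  finally have "AE \<omega> in P. (\<Sum>k. ennreal (norm (D k \<omega>))) \<noteq> \<infinity>"
    by (intro nn_integral_noteq_infinite) auto
  then have conv: "AE \<omega> in P. convergent (\<lambda>k. simple_levy_integral L (G k) B \<omega>)"
  proof eventually_elim
    case (elim \<omega>)
    then have "summable (\<lambda>k. norm (D k \<omega>))" by (intro summable_suminf_not_top) auto
    then have "convergent (\<lambda>n. \<Sum>k<n. D k \<omega>)"
      unfolding summable_iff_convergent[symmetric] by (rule summable_norm_cancel)
    moreover have "(\<Sum>k<n. D k \<omega>) = simple_levy_integral L (G n) B \<omega> - simple_levy_integral L (G 0) B \<omega>" for n
      unfolding D_def by (rule sum_lessThan_telescope)
    ultimately show ?case by (simp add: convergent_diff_const_right_iff)
  qed
  show "(\<lambda>\<omega>. lim (\<lambda>k. simple_levy_integral L (G k) B \<omega>)) \<in> borel_measurable P" by measurable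
  show "AE \<omega> in P. (\<lambda>k. simple_levy_integral L (G k) B \<omega>) \<longlonglongrightarrow> lim (\<lambda>k. simple_levy_integral L (G k) B \<omega>)"
    using conv by eventually_elim (simp add: convergent_LIMSEQ_iff)
qed

lemma rapid_L2_approx_tendsto_in_prob:
  fixes G :: "nat \<Rightarrow> real ^ 'm \<Rightarrow> real ^ 'd ^ 'n"
  assumes "f \<in> borel_measurable borel"
    and G: "\<And>k. levy_simple (G k)"
    and "\<And>k. (\<integral>\<^sup>+ s. ennreal ((norm (G k s - f s))\<^sup>2) \<partial>lborel) \<le> ennreal ((1 / 4) ^ k)"
    and B: "B \<in> sets borel"
  shows "\<exists>Z. tendsto_in_prob P (\<lambda>k. simple_levy_integral L (G k) B) Z"
  by (rule rapid_L2_approx_converges[OF assms])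
     (blast intro: tendsto_in_prob_AE simple_levy_integral_measurable[OF G B])

lemma levy_integrable_L2:
  fixes f :: "real ^ 'm \<Rightarrow> real ^ 'd ^ 'n"
  assumes f: "f \<in> borel_measurable borel" "(\<integral>\<^sup>+ s. ennreal ((norm (f s))\<^sup>2) \<partial>lborel) < \<infinity>"
  shows "levy_integrable P L f"
proof -
  obtain G where G: "\<And>k. levy_simple (G k)" "\<And>s. (\<lambda>k. G k s) \<longlonglongrightarrow> f s"
    "\<And>k. (\<integral>\<^sup>+ s. ennreal ((norm (G k s - f s))\<^sup>2) \<partial>lborel) \<le> ennreal ((1 / 4) ^ k)"
    using L2_approx_levy_simple[OF f] by blast
  have "\<forall>B\<in>sets borel. \<exists>Z. tendsto_in_prob P (\<lambda>k. simple_levy_integral L (G k) B) Z"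
    using rapid_L2_approx_tendsto_in_prob[OF f(1) G(1,3)] by blast
  moreover obtain Y where "tendsto_in_prob P (\<lambda>k. simple_levy_integral L (G k) UNIV) Y"
    using rapid_L2_approx_tendsto_in_prob[OF f(1) G(1,3), of UNIV] by auto
  ultimately have "has_levy_integral P L f UNIV Y"
    unfolding has_levy_integral_def using G f(1) by (auto intro!: exI[of _ G])
  then show ?thesis unfolding levy_integrable_def by blast
qed

text \<open>
  Whatever sequence defines \<open>X\<close>, it is also the almost sure limit along a rapid \<open>L\<^sup>2\<close>
  approximation of \<open>f\<close>: the difference of the two sequences is a null sequence. Fatou's lemma then
  carries the bound for simple functions over to the limit. The factor 2 comes from the triangle
  inequality for squares.
\<close>
lemma has_levy_integral_L2_dist:
  fixes f \<phi> :: "real ^ 'm \<Rightarrow> real ^ 'd ^ 'n"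
  assumes f: "f \<in> borel_measurable borel" "(\<integral>\<^sup>+ s. ennreal ((norm (f s))\<^sup>2) \<partial>lborel) < \<infinity>"
    and X: "has_levy_integral P L f UNIV X"
    and \<phi>: "levy_simple \<phi>"
  shows "(\<integral>\<^sup>+ \<omega>. ennreal ((norm (X \<omega> - simple_levy_integral L \<phi> UNIV \<omega>))\<^sup>2) \<partial>P)
    \<le> ennreal (2 * c) * (\<integral>\<^sup>+ s. ennreal ((norm (f s - \<phi> s))\<^sup>2) \<partial>lborel)"
proof -
  note [measurable] = f(1) levy_simple_measurable[OF \<phi>]
  obtain G where G: "\<And>k. levy_simple (G k)" "\<And>s. (\<lambda>k. G k s) \<longlonglongrightarrow> f s"
    "\<And>k. (\<integral>\<^sup>+ s. ennreal ((norm (G k s - f s))\<^sup>2) \<partial>lborel) \<le> ennreal ((1 / 4) ^ k)"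
    using L2_approx_levy_simple[OF f] by blast
  have [measurable]: "G k \<in> borel_measurable borel" for k using G(1) by (rule levy_simple_measurable)
  obtain F where F: "\<And>k. levy_simple (F k)" "AE s in lborel. (\<lambda>k. F k s) \<longlonglongrightarrow> f s"
    "\<And>B. B \<in> sets borel \<Longrightarrow> \<exists>Z. tendsto_in_prob P (\<lambda>k. simple_levy_integral L (F k) B) Z"
    "tendsto_in_prob P (\<lambda>k. simple_levy_integral L (F k) UNIV) X"
    using X unfolding has_levy_integral_def by auto
  obtain Z where Z: "Z \<in> borel_measurable P" "AE \<omega> in P. (\<lambda>k. simple_levy_integral L (G k) UNIV \<omega>) \<longlonglongrightarrow> Z \<omega>"
    using rapid_L2_approx_converges[OF f(1) G(1,3), of UNIV] by auto
  have GZ: "tendsto_in_prob P (\<lambda>k. simple_levy_integral L (G k) UNIV) Z"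
    using Z by (intro tendsto_in_prob_AE simple_levy_integral_measurable G) auto
  define H where "H k s = F k s - G k s" for k s
  have H: "levy_simple (H k)" for k unfolding H_def by (intro levy_simple_diff F G)
  have H_diff: "tendsto_in_prob P (\<lambda>k. simple_levy_integral L (H k) B) (\<lambda>\<omega>. W \<omega> - W' \<omega>)"
    if B: "B \<in> sets borel" and W: "tendsto_in_prob P (\<lambda>k. simple_levy_integral L (F k) B) W"
      and W': "tendsto_in_prob P (\<lambda>k. simple_levy_integral L (G k) B) W'" for B W W'
  proof (rule tendsto_in_prob_cong_AE[OF tendsto_in_prob_diff[OF W W']])
    show "simple_levy_integral L (H k) B \<in> borel_measurable P" for k
      by (rule simple_levy_integral_measurable[OF H B])
    show "AE \<omega> in P. simple_levy_integral L (F k) B \<omega> - simple_levy_integral L (G k) B \<omega>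
        = simple_levy_integral L (H k) B \<omega>" for k
      using simple_levy_integral_diff[OF F(1) G(1) B, of k k] unfolding H_def by (auto elim!: eventually_mono)
  qed
  have "AE \<omega> in P. X \<omega> - Z \<omega> = 0"
  proof (rule limit_of_null_sequence[of H])
    show "AE s in lborel. (\<lambda>k. H k s) \<longlonglongrightarrow> 0"
      using F(2)
    proof eventually_elim
      case (elim s)
      from tendsto_diff[OF this G(2)[of s]] show ?case by (simp add: H_def)
    qed
    show "\<exists>W. tendsto_in_prob P (\<lambda>k. simple_levy_integral L (H k) B) W" if B: "B \<in> sets borel" for B
      using F(3)[OF B] rapid_L2_approx_tendsto_in_prob[OF f(1) G(1,3) B] H_diff[OF B] by blast
    show "tendsto_in_prob P (\<lambda>k. simple_levy_integral L (H k) UNIV) (\<lambda>\<omega>. X \<omega> - Z \<omega>)"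
      by (rule H_diff[OF _ F(4) GZ]) simp
  qed (rule H)
  with Z(2) have X_lim: "AE \<omega> in P. (\<lambda>k. simple_levy_integral L (G k) UNIV \<omega>) \<longlonglongrightarrow> X \<omega>"
    by eventually_elim simp
  have [measurable]: "simple_levy_integral L (G k) UNIV \<in> borel_measurable P" for k
    by (intro simple_levy_integral_measurable G) simp
  have [measurable]: "simple_levy_integral L \<phi> UNIV \<in> borel_measurable P"
    by (intro simple_levy_integral_measurable \<phi>) simp
  let ?I = "\<integral>\<^sup>+ s. ennreal ((norm (f s - \<phi> s))\<^sup>2) \<partial>lborel"
  have "(\<integral>\<^sup>+ \<omega>. ennreal ((norm (X \<omega> - simple_levy_integral L \<phi> UNIV \<omega>))\<^sup>2) \<partial>P)
      = (\<integral>\<^sup>+ \<omega>. liminf (\<lambda>k. ennreal ((norm (simple_levy_integral L (G k) UNIV \<omega> - simple_levy_integral L \<phi> UNIV \<omega>))\<^sup>2)) \<partial>P)"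
  proof (rule nn_integral_cong_AE)
    show "AE \<omega> in P. ennreal ((norm (X \<omega> - simple_levy_integral L \<phi> UNIV \<omega>))\<^sup>2)
        = liminf (\<lambda>k. ennreal ((norm (simple_levy_integral L (G k) UNIV \<omega> - simple_levy_integral L \<phi> UNIV \<omega>))\<^sup>2))"
      using X_lim
    proof eventually_elim
      case (elim \<omega>)
      have "(\<lambda>k. ennreal ((norm (simple_levy_integral L (G k) UNIV \<omega> - simple_levy_integral L \<phi> UNIV \<omega>))\<^sup>2))
          \<longlonglongrightarrow> ennreal ((norm (X \<omega> - simple_levy_integral L \<phi> UNIV \<omega>))\<^sup>2)"
        by (intro tendsto_intros elim)
      from lim_imp_Liminf[OF _ this] show ?case by simp
    qed
  qed
  also have "\<dots> \<le> liminf (\<lambda>k. \<integral>\<^sup>+ \<omega>. ennreal ((norm (simple_levy_integral L (G k) UNIV \<omega> - simple_levy_integral L \<phi> UNIV \<omega>))\<^sup>2) \<partial>P)"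
    by (rule nn_integral_liminf) measurable
  also have "\<dots> \<le> liminf (\<lambda>k. ennreal (2 * c) * (ennreal ((1 / 4) ^ k) + ?I))"
  proof (intro Liminf_mono always_eventually allI)
    fix k
    have "(\<integral>\<^sup>+ \<omega>. ennreal ((norm (simple_levy_integral L (G k) UNIV \<omega> - simple_levy_integral L \<phi> UNIV \<omega>))\<^sup>2) \<partial>P)
        \<le> ennreal c * (\<integral>\<^sup>+ s. ennreal ((norm (G k s - \<phi> s))\<^sup>2) \<partial>lborel)"
      by (rule simple_levy_integral_diff_L2_bound[OF G(1) \<phi>]) simp
    also have "(\<integral>\<^sup>+ s. ennreal ((norm (G k s - \<phi> s))\<^sup>2) \<partial>lborel)
        \<le> (\<integral>\<^sup>+ s. 2 * (ennreal ((norm (G k s - f s))\<^sup>2) + ennreal ((norm (f s - \<phi> s))\<^sup>2)) \<partial>lborel)"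
    proof (rule nn_integral_mono)
      fix s
      have "(norm (G k s - \<phi> s))\<^sup>2 \<le> 2 * ((norm (G k s - f s))\<^sup>2 + (norm (f s - \<phi> s))\<^sup>2)"
        using norm_add_sq_le[of "G k s - f s" "f s - \<phi> s"] by simp
      then show "ennreal ((norm (G k s - \<phi> s))\<^sup>2)
          \<le> 2 * (ennreal ((norm (G k s - f s))\<^sup>2) + ennreal ((norm (f s - \<phi> s))\<^sup>2))"
        by (simp add: ennreal_leI ennreal_mult''[symmetric] ennreal_plus[symmetric]
              flip: ennreal_numeral del: ennreal_plus)
    qed
    also have "\<dots> = 2 * ((\<integral>\<^sup>+ s. ennreal ((norm (G k s - f s))\<^sup>2) \<partial>lborel) + ?I)"
      by (simp add: nn_integral_add nn_integral_cmult)
    also have "\<dots> \<le> 2 * (ennreal ((1 / 4) ^ k) + ?I)"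
      by (intro mult_left_mono add_right_mono G) simp
    also have "ennreal c * \<dots> = ennreal (2 * c) * (ennreal ((1 / 4) ^ k) + ?I)"
      using c_pos by (simp add: ennreal_mult' mult.assoc mult.left_commute)
    finally show "(\<integral>\<^sup>+ \<omega>. ennreal ((norm (simple_levy_integral L (G k) UNIV \<omega> - simple_levy_integral L \<phi> UNIV \<omega>))\<^sup>2) \<partial>P)
        \<le> ennreal (2 * c) * (ennreal ((1 / 4) ^ k) + ?I)"
      by (simp add: mult_left_mono)
  qed
  also have "\<dots> = ennreal (2 * c) * ?I"
  proof (rule lim_imp_Liminf)
    have "(\<lambda>k. ennreal ((1 / 4) ^ k)) \<longlonglongrightarrow> ennreal 0"
      by (intro tendsto_ennrealI LIMSEQ_power_zero) simp
    then have "(\<lambda>k. ennreal (2 * c) * (ennreal ((1 / 4) ^ k) + ?I)) \<longlonglongrightarrow> ennreal (2 * c) * (ennreal 0 + ?I)"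
      by (intro ennreal_tendsto_cmult tendsto_add tendsto_const) auto
    then show "(\<lambda>k. ennreal (2 * c) * (ennreal ((1 / 4) ^ k) + ?I)) \<longlonglongrightarrow> ennreal (2 * c) * ?I" by simp
  qed simp
  finally show ?thesis .
qed

end

section \<open>Covariances of test functions\<close>

lemma bounded_test_function:
  assumes "F \<in> test_functions u" "x \<in> tuples u"
  shows "\<bar>F x\<bar> \<le> sup_norm u F"
proof -
  have "bounded (F ` tuples u)" using assms(1) by (simp add: test_functions_def)
  then have "bdd_above ((\<lambda>x. \<bar>F x\<bar>) ` tuples u)"
    by (auto simp: bounded_iff bdd_above_def)
  then show ?thesis unfolding sup_norm_def by (rule cSUP_upper2[OF _ assms(2)]) simp
qed

lemma Lip_test_function:
  assumes F: "F \<in> test_functions u" and x: "x \<in> tuples u" and y: "y \<in> tuples u"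
  shows "\<bar>F x - F y\<bar> \<le> Lip u F * (\<Sum>i<u. norm (x i - y i))" "0 \<le> Lip u F"
proof -
  obtain K where K: "tuple_lipschitz u K F" using F by (auto simp: test_functions_def)
  let ?S = "\<Sum>i<u. norm (x i - y i)"
  have le: "\<bar>F x - F y\<bar> \<le> K' * ?S" if "tuple_lipschitz u K' F" for K'
    using that x y by (auto simp: tuple_lipschitz_def)
  have "0 \<le> ?S" by (intro sum_nonneg) simp
  show "0 \<le> Lip u F"
    unfolding Lip_def using K by (intro cInf_greatest) (auto simp: tuple_lipschitz_def)
  show "\<bar>F x - F y\<bar> \<le> Lip u F * ?S"
  proof (cases "?S = 0")
    case True
    with le[OF K] show ?thesis by simp
  next
    case False
    with \<open>0 \<le> ?S\<close> have "0 < ?S" by simp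
    have "\<bar>F x - F y\<bar> / ?S \<le> Lip u F"
      unfolding Lip_def
    proof (rule cInf_greatest)
      show "{K. tuple_lipschitz u K F} \<noteq> {}" using K by auto
      show "\<bar>F x - F y\<bar> / ?S \<le> K'" if "K' \<in> {K. tuple_lipschitz u K F}" for K'
        using le[of K'] that \<open>0 < ?S\<close> by (simp add: divide_le_eq)
    qed
    with \<open>0 < ?S\<close> show ?thesis by (simp add: divide_le_eq)
  qed
qed

lemma restrict_in_tuples: "restrict x {..<u} \<in> tuples u"
  by simp

text \<open>
  A test function is controlled only on extensional tuples. Composed with the restriction it becomes
  continuous in the product topology on all sequences, so that the measurability of a sample reduces
  to that of its coordinates.
\<close>
lemma test_function_measurable:
  assumes F: "F \<in> test_functions u"
  shows "(\<lambda>x. F (restrict x {..<u})) \<in> borel_measurable borel"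
proof (rule borel_measurable_continuous_onI)
  show "continuous_on UNIV (\<lambda>x. F (restrict x {..<u}))"
    unfolding continuous_on_def
  proof
    fix x :: "nat \<Rightarrow> real ^ 'a"
    have "((\<lambda>y. y i) \<longlongrightarrow> x i) (at x)" for i
    proof -
      have "continuous_on UNIV (\<lambda>y :: nat \<Rightarrow> real ^ 'a. y i)" by (rule continuous_on_product_coordinates)
      then show ?thesis by (simp add: continuous_on_def)
    qed
    then have "((\<lambda>y. Lip u F * (\<Sum>i<u. norm (y i - x i))) \<longlongrightarrow> Lip u F * (\<Sum>i<u. norm (x i - x i))) (at x)"
      by (intro tendsto_intros)
    then have "((\<lambda>y. Lip u F * (\<Sum>i<u. norm (y i - x i))) \<longlongrightarrow> 0) (at x)" by simp
    then have "((\<lambda>y. F (restrict y {..<u}) - F (restrict x {..<u})) \<longlongrightarrow> 0) (at x)"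
    proof (rule Lim_null_comparison[rotated], intro always_eventually allI)
      fix y
      have "(\<Sum>i<u. norm (restrict y {..<u} i - restrict x {..<u} i)) = (\<Sum>i<u. norm (y i - x i))"
        by (intro sum.cong) auto
      then show "norm (F (restrict y {..<u}) - F (restrict x {..<u})) \<le> Lip u F * (\<Sum>i<u. norm (y i - x i))"
        using Lip_test_function(1)[OF F restrict_in_tuples restrict_in_tuples, of y x] by simp
    qed
    then show "((\<lambda>x. F (restrict x {..<u})) \<longlongrightarrow> F (restrict x {..<u})) (at x)"
      by (simp add: LIM_zero_iff)
  qed
qed

lemma test_function_sample_measurable:
  assumes F: "F \<in> test_functions u" and X: "\<And>i. i < u \<Longrightarrow> Y i \<in> borel_measurable M"
  shows "(\<lambda>\<omega>. F (\<lambda>i\<in>{..<u}. Y i \<omega>)) \<in> borel_measurable M"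
proof -
  have "(\<lambda>\<omega>. \<lambda>i. if i < u then Y i \<omega> else 0) \<in> borel_measurable M"
  proof (rule measurable_coordinatewise_then_product)
    show "(\<lambda>\<omega>. if i < u then Y i \<omega> else 0) \<in> borel_measurable M" for i
      using X[of i] by (cases "i < u") auto
  qed
  from measurable_compose[OF this test_function_measurable[OF F]]
  show ?thesis by (simp add: restrict_def cong: if_cong)
qed

lemma simple_function_tuple:
  assumes "finite I" "\<And>i. i \<in> I \<Longrightarrow> simple_function M (f i)"
  shows "simple_function M (\<lambda>s. \<lambda>i\<in>I. f i s)"
  using assms
proof (induction I)
  case empty
  then show ?case by simp
next
  case (insert x I)
  have "(\<lambda>s. \<lambda>i\<in>insert x I. f i s) = (\<lambda>s. (\<lambda>i\<in>I. f i s)(x := f x s))"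
    using insert.hyps by (auto simp: fun_eq_iff restrict_def)
  moreover have "simple_function M (\<lambda>s. (\<lambda>i\<in>I. f i s)(x := f x s))"
  proof (rule simple_function_compose2[where h="\<lambda>h y. h(x := y)"])
    show "simple_function M (\<lambda>s. \<lambda>i\<in>I. f i s)" by (rule insert.IH) (simp add: insert.prems)
    show "simple_function M (f x)" by (simp add: insert.prems)
  qed
  ultimately show ?case by (simp only:)
qed

lemma covariance_cong_AE:
  assumes [measurable]: "U \<in> borel_measurable M" "V \<in> borel_measurable M"
      "U' \<in> borel_measurable M" "V' \<in> borel_measurable M"
    and "AE \<omega> in M. U \<omega> = U' \<omega>" "AE \<omega> in M. V \<omega> = V' \<omega>"
  shows "covariance M U V = covariance M U' V'"
proof -
  have "integral\<^sup>L M U = integral\<^sup>L M U'" "integral\<^sup>L M V = integral\<^sup>L M V'"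
    using assms by (auto intro!: integral_cong_AE)
  moreover have "AE \<omega> in M. (U \<omega> - a) * (V \<omega> - b) = (U' \<omega> - a) * (V' \<omega> - b)" for a b
    using assms(5,6) by eventually_elim simp
  ultimately show ?thesis
    unfolding covariance_def by (simp, intro integral_cong_AE) auto
qed

context prob_space
begin

lemma covariance_eq_bounded:
  assumes [measurable]: "U \<in> borel_measurable M" "V \<in> borel_measurable M"
    and U: "\<And>\<omega>. \<bar>U \<omega>\<bar> \<le> a" and V: "\<And>\<omega>. \<bar>V \<omega>\<bar> \<le> b"
  shows "covariance M U V = expectation (\<lambda>\<omega>. U \<omega> * V \<omega>) - expectation U * expectation V"
proof -
  have int: "integrable M U" "integrable M V"
    using U V by (auto intro: integrable_const_bound[of _ a] integrable_const_bound[of _ b])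
  have "integrable M (\<lambda>\<omega>. U \<omega> * V \<omega>)"
    using U V by (intro integrable_const_bound[of _ "a * b"]) (auto simp: abs_mult intro!: mult_mono order_trans[OF abs_ge_zero U])
  with int show ?thesis
    unfolding covariance_def
    by (simp add: left_diff_distrib right_diff_distrib prob_space)
qed

text \<open>
  The perturbed factors are exchanged one at a time; each exchange costs the bound on the other
  factor times the mean error, once in the mean of the product and once in the product of means.
\<close>
lemma covariance_perturbation:
  assumes [measurable]: "U \<in> borel_measurable M" "V \<in> borel_measurable M"
      "U' \<in> borel_measurable M" "V' \<in> borel_measurable M"
    and U: "\<And>\<omega>. \<bar>U \<omega>\<bar> \<le> a" and V: "\<And>\<omega>. \<bar>V \<omega>\<bar> \<le> b"
    and U': "\<And>\<omega>. \<bar>U' \<omega>\<bar> \<le> a" and V': "\<And>\<omega>. \<bar>V' \<omega>\<bar> \<le> b"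
  shows "\<bar>covariance M U V - covariance M U' V'\<bar>
    \<le> 2 * b * expectation (\<lambda>\<omega>. \<bar>U \<omega> - U' \<omega>\<bar>) + 2 * a * expectation (\<lambda>\<omega>. \<bar>V \<omega> - V' \<omega>\<bar>)"
proof -
  have "0 \<le> a" "0 \<le> b" using order_trans[OF abs_ge_zero U] order_trans[OF abs_ge_zero V] by auto
  have bound: "integrable M f" if "f \<in> borel_measurable M" "\<And>\<omega>. \<bar>f \<omega>\<bar> \<le> k" for f :: "'a \<Rightarrow> real" and k
    using that by (auto intro!: integrable_const_bound[of _ k])
  have prod: "integrable M (\<lambda>\<omega>. f \<omega> * g \<omega>)"
    if "f \<in> borel_measurable M" "g \<in> borel_measurable M" "\<And>\<omega>. \<bar>f \<omega>\<bar> \<le> k" "\<And>\<omega>. \<bar>g \<omega>\<bar> \<le> l"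
    for f g :: "'a \<Rightarrow> real" and k l
    using that(1,2) by (intro bound[of _ "k * l"])
      (auto simp: abs_mult intro!: mult_mono that order_trans[OF abs_ge_zero that(3)])
  have iU: "integrable M U" and iV: "integrable M V" and iU': "integrable M U'" and iV': "integrable M V'"
    by (fact bound[OF assms(1) U] bound[OF assms(2) V] bound[OF assms(3) U'] bound[OF assms(4) V'])+
  have UV: "integrable M (\<lambda>\<omega>. U \<omega> * V \<omega>)" "integrable M (\<lambda>\<omega>. U' \<omega> * V \<omega>)" "integrable M (\<lambda>\<omega>. U' \<omega> * V' \<omega>)"
    by (fact prod[OF assms(1,2) U V] prod[OF assms(3,2) U' V] prod[OF assms(3,4) U' V'])+
  define d where "d = expectation (\<lambda>\<omega>. \<bar>U \<omega> - U' \<omega>\<bar>)"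
  define e where "e = expectation (\<lambda>\<omega>. \<bar>V \<omega> - V' \<omega>\<bar>)"
  have "\<bar>expectation (\<lambda>\<omega>. U \<omega> * V \<omega>) - expectation (\<lambda>\<omega>. U' \<omega> * V \<omega>)\<bar> \<le> b * d"
  proof -
    have "\<bar>expectation (\<lambda>\<omega>. U \<omega> * V \<omega>) - expectation (\<lambda>\<omega>. U' \<omega> * V \<omega>)\<bar> = \<bar>expectation (\<lambda>\<omega>. (U \<omega> - U' \<omega>) * V \<omega>)\<bar>"
      using UV by (simp add: left_diff_distrib)
    also have "\<dots> \<le> expectation (\<lambda>\<omega>. \<bar>(U \<omega> - U' \<omega>) * V \<omega>\<bar>)" by (rule integral_abs_bound)
    also have "\<dots> \<le> expectation (\<lambda>\<omega>. b * \<bar>U \<omega> - U' \<omega>\<bar>)"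
    proof (rule integral_mono)
      show "integrable M (\<lambda>\<omega>. \<bar>(U \<omega> - U' \<omega>) * V \<omega>\<bar>)" using UV by (simp add: left_diff_distrib)
      show "\<bar>(U \<omega> - U' \<omega>) * V \<omega>\<bar> \<le> b * \<bar>U \<omega> - U' \<omega>\<bar>" for \<omega>
        using mult_right_mono[OF V[of \<omega>], of "\<bar>U \<omega> - U' \<omega>\<bar>"] by (simp add: abs_mult mult.commute)
    qed (use iU iU' in auto)
    finally show ?thesis by (simp add: d_def)
  qed
  moreover have "\<bar>expectation (\<lambda>\<omega>. U' \<omega> * V \<omega>) - expectation (\<lambda>\<omega>. U' \<omega> * V' \<omega>)\<bar> \<le> a * e"
  proof -
    have "\<bar>expectation (\<lambda>\<omega>. U' \<omega> * V \<omega>) - expectation (\<lambda>\<omega>. U' \<omega> * V' \<omega>)\<bar> = \<bar>expectation (\<lambda>\<omega>. U' \<omega> * (V \<omega> - V' \<omega>))\<bar>"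
      using UV by (simp add: right_diff_distrib)
    also have "\<dots> \<le> expectation (\<lambda>\<omega>. \<bar>U' \<omega> * (V \<omega> - V' \<omega>)\<bar>)" by (rule integral_abs_bound)
    also have "\<dots> \<le> expectation (\<lambda>\<omega>. a * \<bar>V \<omega> - V' \<omega>\<bar>)"
    proof (rule integral_mono)
      show "integrable M (\<lambda>\<omega>. \<bar>U' \<omega> * (V \<omega> - V' \<omega>)\<bar>)" using UV by (simp add: right_diff_distrib)
      show "\<bar>U' \<omega> * (V \<omega> - V' \<omega>)\<bar> \<le> a * \<bar>V \<omega> - V' \<omega>\<bar>" for \<omega>
        using mult_right_mono[OF U'[of \<omega>], of "\<bar>V \<omega> - V' \<omega>\<bar>"] by (simp add: abs_mult)
    qed (use iV iV' in auto)
    finally show ?thesis by (simp add: e_def)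
  qed
  moreover have "\<bar>(expectation U - expectation U') * expectation V\<bar> \<le> d * b"
    unfolding abs_mult
  proof (intro mult_mono)
    show "\<bar>expectation U - expectation U'\<bar> \<le> d"
      unfolding d_def using integral_abs_bound[of M "\<lambda>\<omega>. U \<omega> - U' \<omega>"] iU iU' by simp
    show "\<bar>expectation V\<bar> \<le> b"
      using order_trans[OF integral_abs_bound integral_mono[of M "\<lambda>\<omega>. \<bar>V \<omega>\<bar>" "\<lambda>_. b"]] iV V by (simp add: prob_space)
  qed (auto simp: d_def)
  moreover have "\<bar>expectation U' * (expectation V - expectation V')\<bar> \<le> a * e"
    unfolding abs_mult
  proof (intro mult_mono)
    show "\<bar>expectation V - expectation V'\<bar> \<le> e"
      unfolding e_def using integral_abs_bound[of M "\<lambda>\<omega>. V \<omega> - V' \<omega>"] iV iV' by simp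
    show "\<bar>expectation U'\<bar> \<le> a"
      using order_trans[OF integral_abs_bound integral_mono[of M "\<lambda>\<omega>. \<bar>U' \<omega>\<bar>" "\<lambda>_. a"]] iU' U' by (simp add: prob_space)
  qed (use \<open>0 \<le> a\<close> in auto)
  moreover have "covariance M U V - covariance M U' V'
      = (expectation (\<lambda>\<omega>. U \<omega> * V \<omega>) - expectation (\<lambda>\<omega>. U' \<omega> * V \<omega>))
      + (expectation (\<lambda>\<omega>. U' \<omega> * V \<omega>) - expectation (\<lambda>\<omega>. U' \<omega> * V' \<omega>))
      - (expectation U - expectation U') * expectation V
      - expectation U' * (expectation V - expectation V')"
    using covariance_eq_bounded[OF assms(1,2) U V] covariance_eq_bounded[OF assms(3,4) U' V']
    by (simp add: algebra_simps)
  ultimately show ?thesis unfolding d_def[symmetric] e_def[symmetric] by (simp add: mult.assoc mult.commute[of d b])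
qed

end

context levy_basis
begin

text \<open>
  All \<open>\<phi> i\<close> and \<open>\<psi> j\<close> are factored through one simple function. As their supports do not meet, no
  cell carries both some \<open>\<phi> i\<close> and some \<open>\<psi> j\<close>, so that the two families of integrals are functions
  of disjoint sets of independent variables.
\<close>
lemma covariance_disjoint_supports:
  fixes \<phi> \<psi> :: "nat \<Rightarrow> real ^ 'm \<Rightarrow> real ^ 'd ^ 'n"
  assumes \<phi>: "\<And>i. i < u \<Longrightarrow> levy_simple (\<phi> i)" and \<psi>: "\<And>j. j < v \<Longrightarrow> levy_simple (\<psi> j)"
    and disj: "\<And>i j s. i < u \<Longrightarrow> j < v \<Longrightarrow> \<phi> i s = 0 \<or> \<psi> j s = 0"
    and F: "F \<in> test_functions u" and G: "G \<in> test_functions v"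
  shows "covariance P (\<lambda>\<omega>. F (\<lambda>i\<in>{..<u}. simple_levy_integral L (\<phi> i) UNIV \<omega>))
    (\<lambda>\<omega>. G (\<lambda>j\<in>{..<v}. simple_levy_integral L (\<psi> j) UNIV \<omega>)) = 0"
proof -
  \<comment> \<open>The concatenation of the two families; index \<open>u + j\<close> refers to \<open>\<psi> j\<close>.\<close>
  define \<theta> where "\<theta> i = (if i < u then \<phi> i else \<psi> (i - u))" for i
  have \<theta>: "levy_simple (\<theta> i)" if "i < u + v" for i
    using that \<phi>[of i] \<psi>[of "i - u"] by (auto simp: \<theta>_def)
  have "simple_function borel (\<lambda>s. \<lambda>i\<in>{..<u + v}. \<theta> i s)"
    using \<theta> by (intro simple_function_tuple) (auto simp: levy_simple_def)
  then obtain T :: "real ^ 'm \<Rightarrow> nat" and q where T: "simple_function borel T"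
    and q: "\<And>s. (\<lambda>i\<in>{..<u + v}. \<theta> i s) = q (T s)"
    by (rule simple_function_code) auto
  have \<theta>q: "\<theta> i = (\<lambda>s. q (T s) i)" if "i < u + v" for i
    using that by (simp add: q[symmetric])
  have fin: "finite (range T)" using simple_functionD(1)[OF T] by simp
  define A where "A = {b \<in> range T. \<exists>i<u. q b i \<noteq> 0}"
  define B where "B = {b \<in> range T. \<exists>j<v. q b (u + j) \<noteq> 0}"
  have finAB: "finite A" "finite B" using fin by (auto simp: A_def B_def)
  have "A \<inter> B = {}"
  proof (rule ccontr)
    assume "A \<inter> B \<noteq> {}"
    then obtain s i j where "i < u" "j < v" "q (T s) i \<noteq> 0" "q (T s) (u + j) \<noteq> 0"
      by (auto simp: A_def B_def)
    then have "\<phi> i s \<noteq> 0" "\<psi> j s \<noteq> 0"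
      using fun_cong[OF \<theta>q, of i s] fun_cong[OF \<theta>q, of "u + j" s] by (auto simp: \<theta>_def)
    with disj \<open>i < u\<close> \<open>j < v\<close> show False by blast
  qed
  define C where "C b = L (cell UNIV T b)" for b
  note cell = bounded_borel_cell[OF T, of UNIV, simplified]
  have ind: "indep_vars (\<lambda>_. borel) C UNIV"
    unfolding C_def by (rule independent[OF disjoint_family_cell cell])
  define f where "f x = F (\<lambda>i\<in>{..<u}. \<Sum>b\<in>A. q b i *v x b)" for x
  define g where "g x = G (\<lambda>j\<in>{..<v}. \<Sum>b\<in>B. q b (u + j) *v x b)" for x
  have f_meas [measurable]: "f \<in> borel_measurable (PiM A (\<lambda>_. borel))"
    unfolding f_def
    by (intro test_function_sample_measurable[OF F] borel_measurable_sum matrix_vector_measurable) simp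
  have g_meas [measurable]: "g \<in> borel_measurable (PiM B (\<lambda>_. borel))"
    unfolding g_def
    by (intro test_function_sample_measurable[OF G] borel_measurable_sum matrix_vector_measurable) simp
  have "indep_var (PiM A (\<lambda>_. borel)) (\<lambda>\<omega>. restrict (\<lambda>b. C b \<omega>) A) (PiM B (\<lambda>_. borel)) (\<lambda>\<omega>. restrict (\<lambda>b. C b \<omega>) B)"
    by (rule indep_var_restrict[OF ind \<open>A \<inter> B = {}\<close>]) auto
  from indep_var_compose[OF this f_meas g_meas]
  have indep: "indep_var borel (\<lambda>\<omega>. f (restrict (\<lambda>b. C b \<omega>) A)) borel (\<lambda>\<omega>. g (restrict (\<lambda>b. C b \<omega>) B))"
    by (simp add: o_def)
  define U where "U \<omega> = f (restrict (\<lambda>b. C b \<omega>) A)" for \<omega>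
  define V where "V \<omega> = g (restrict (\<lambda>b. C b \<omega>) B)" for \<omega>
  have UV_meas [measurable]: "U \<in> borel_measurable P" "V \<in> borel_measurable P"
    unfolding U_def[abs_def] V_def[abs_def] by (rule indep_var_rv1[OF indep], rule indep_var_rv2[OF indep])
  have Ub: "\<bar>U \<omega>\<bar> \<le> sup_norm u F" and Vb: "\<bar>V \<omega>\<bar> \<le> sup_norm v G" for \<omega>
    unfolding U_def V_def f_def g_def by (rule bounded_test_function[OF _ restrict_in_tuples], fact)+
  have int: "integrable P U" "integrable P V"
    using Ub Vb by (auto intro: integrable_const_bound[of _ "sup_norm u F"] integrable_const_bound[of _ "sup_norm v G"])
  have "expectation (\<lambda>\<omega>. U \<omega> * V \<omega>) = expectation U * expectation V"
    using indep int unfolding U_def[symmetric] V_def[symmetric] by (rule indep_var_lebesgue_integral)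
  then have "covariance P U V = 0"
    using covariance_eq_bounded[OF UV_meas Ub Vb] by simp
  moreover have "AE \<omega> in P. F (\<lambda>i\<in>{..<u}. simple_levy_integral L (\<phi> i) UNIV \<omega>) = U \<omega>"
  proof -
    have "AE \<omega> in P. \<forall>i\<in>{..<u}. simple_levy_integral L (\<phi> i) UNIV \<omega> = (\<Sum>b\<in>range T. q b i *v C b \<omega>)"
    proof (rule AE_finite_allI)
      fix i assume "i \<in> {..<u}"
      then show "AE \<omega> in P. simple_levy_integral L (\<phi> i) UNIV \<omega> = (\<Sum>b\<in>range T. q b i *v C b \<omega>)"
        unfolding C_def using \<phi>[of i] \<theta>q[of i] by (intro simple_levy_integral_coded[OF T]) (auto simp: \<theta>_def)
    qed simp
    then show ?thesis
    proof eventually_elim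
      case (elim \<omega>)
      have "(\<Sum>b\<in>range T. q b i *v C b \<omega>) = (\<Sum>b\<in>A. q b i *v restrict (\<lambda>b. C b \<omega>) A b)" if "i < u" for i
        using that fin by (intro sum.mono_neutral_cong_right) (auto simp: A_def)
      with elim have "(\<lambda>i\<in>{..<u}. simple_levy_integral L (\<phi> i) UNIV \<omega>)
          = (\<lambda>i\<in>{..<u}. \<Sum>b\<in>A. q b i *v restrict (\<lambda>b. C b \<omega>) A b)"
        by (intro restrict_ext) auto
      then show ?case by (simp add: U_def f_def)
    qed
  qed
  moreover have "AE \<omega> in P. G (\<lambda>j\<in>{..<v}. simple_levy_integral L (\<psi> j) UNIV \<omega>) = V \<omega>"
  proof -
    have "AE \<omega> in P. \<forall>j\<in>{..<v}. simple_levy_integral L (\<psi> j) UNIV \<omega> = (\<Sum>b\<in>range T. q b (u + j) *v C b \<omega>)"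
    proof (rule AE_finite_allI)
      fix j assume "j \<in> {..<v}"
      then show "AE \<omega> in P. simple_levy_integral L (\<psi> j) UNIV \<omega> = (\<Sum>b\<in>range T. q b (u + j) *v C b \<omega>)"
        unfolding C_def using \<psi>[of j] \<theta>q[of "u + j"] by (intro simple_levy_integral_coded[OF T]) (auto simp: \<theta>_def)
    qed simp
    then show ?thesis
    proof eventually_elim
      case (elim \<omega>)
      have "(\<Sum>b\<in>range T. q b (u + j) *v C b \<omega>) = (\<Sum>b\<in>B. q b (u + j) *v restrict (\<lambda>b. C b \<omega>) B b)" if "j < v" for j
        using that fin by (intro sum.mono_neutral_cong_right) (auto simp: B_def)
      with elim have "(\<lambda>j\<in>{..<v}. simple_levy_integral L (\<psi> j) UNIV \<omega>)
          = (\<lambda>j\<in>{..<v}. \<Sum>b\<in>B. q b (u + j) *v restrict (\<lambda>b. C b \<omega>) B b)"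
        by (intro restrict_ext) auto
      then show ?case by (simp add: V_def g_def)
    qed
  qed
  moreover have "(\<lambda>\<omega>. F (\<lambda>i\<in>{..<u}. simple_levy_integral L (\<phi> i) UNIV \<omega>)) \<in> borel_measurable P"
    by (intro test_function_sample_measurable[OF F] simple_levy_integral_measurable \<phi>) auto
  moreover have "(\<lambda>\<omega>. G (\<lambda>j\<in>{..<v}. simple_levy_integral L (\<psi> j) UNIV \<omega>)) \<in> borel_measurable P"
    by (intro test_function_sample_measurable[OF G] simple_levy_integral_measurable \<psi>) auto
  ultimately show ?thesis
    by (subst covariance_cong_AE[where U'=U and V'=V]) auto
qed

end

section \<open>Exponential decay\<close>

lemma power_le_fact_exp:
  fixes y :: real
  assumes "0 \<le> y"
  shows "y ^ m \<le> fact m * exp y"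
proof -
  have "(\<Sum>n\<in>{m}. y ^ n /\<^sub>R fact n) \<le> (\<Sum>n. y ^ n /\<^sub>R fact n)"
    using assms by (intro sum_le_suminf summable_exp_generic) auto
  then show ?thesis by (simp add: exp_def field_simps)
qed

text \<open>
  The integrand is dominated layer by layer: on the layer where the floor of \<open>norm (t - s)\<close> is \<open>k\<close>
  it is at most \<open>exp (- K * k)\<close>, and the volume of the ball of radius \<open>k + 1\<close> grows only
  polynomially. As this volume does not depend on the centre, neither does the bound.
\<close>
lemma nn_integral_exp_norm_bounded:
  assumes "0 < K"
  obtains C where "0 \<le> C" "\<And>t :: 'a :: euclidean_space.
    (\<integral>\<^sup>+ s. ennreal (exp (- K * norm (t - s))) \<partial>lborel) \<le> ennreal C"
proof
  define m where "m = DIM('a)"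
  define V where "V = unit_ball_vol (real m)"
  define a where "a k = exp (- K * real k) * (V * (real k + 1) ^ m)" for k :: nat
  have "0 \<le> V" by (simp add: V_def)
  have a_nonneg: "0 \<le> a k" for k using \<open>0 \<le> V\<close> by (simp add: a_def)
  have "summable a"
  proof (rule summable_comparison_test')
    let ?D = "V * fact m * (2 / K) ^ m * exp (K / 2)"
    show "summable (\<lambda>k. ?D * exp (- K / 2) ^ k)"
      using assms by (intro summable_mult summable_geometric) simp
    show "norm (a k) \<le> ?D * exp (- K / 2) ^ k" for k
    proof -
      \<comment> \<open>Half of the exponential decay absorbs the polynomial volume growth.\<close>
      have "(K / 2 * (real k + 1)) ^ m \<le> fact m * exp (K / 2 * (real k + 1))"
        using assms by (intro power_le_fact_exp) simp
      then have "(2 / K) ^ m * (K / 2 * (real k + 1)) ^ m \<le> (2 / K) ^ m * (fact m * exp (K / 2 * (real k + 1)))"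
        using assms by (intro mult_left_mono) auto
      also have "(2 / K) ^ m * (K / 2 * (real k + 1)) ^ m = (real k + 1) ^ m"
        using assms by (simp add: power_mult_distrib power_divide)
      finally have "a k \<le> exp (- K * real k) * (V * ((2 / K) ^ m * (fact m * exp (K / 2 * (real k + 1)))))"
        unfolding a_def using \<open>0 \<le> V\<close> by (intro mult_left_mono) auto
      also have "\<dots> = V * fact m * (2 / K) ^ m * (exp (- K * real k) * exp (K / 2 * (real k + 1)))"
        by (simp add: mult_ac)
      also have "exp (- K * real k) * exp (K / 2 * (real k + 1)) = exp (K / 2) * exp (- K / 2) ^ k"
        by (simp add: exp_of_nat_mult[symmetric] exp_add[symmetric] field_simps)
      finally show ?thesis using a_nonneg[of k] by (simp add: mult_ac)
    qed
  qed
  then show "0 \<le> suminf a" using a_nonneg by (rule suminf_nonneg)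
  fix t :: 'a
  have "(\<integral>\<^sup>+ s. ennreal (exp (- K * norm (t - s))) \<partial>lborel)
      \<le> (\<integral>\<^sup>+ s. (\<Sum>k. ennreal (exp (- K * real k)) * indicator (ball t (real k + 1)) s) \<partial>lborel)"
  proof (rule nn_integral_mono)
    fix s :: 'a
    define k where "k = nat \<lfloor>norm (t - s)\<rfloor>"
    have k: "real k \<le> norm (t - s)" "norm (t - s) < real k + 1" using floor_correct[of "norm (t - s)"] by (auto simp: k_def)
    have "ennreal (exp (- K * norm (t - s))) \<le> (\<Sum>k\<in>{k}. ennreal (exp (- K * real k)) * indicator (ball t (real k + 1)) s)"
      using k assms by (simp add: dist_norm ennreal_leI)
    also have "\<dots> \<le> (\<Sum>k. ennreal (exp (- K * real k)) * indicator (ball t (real k + 1)) s)"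
      by (rule sum_le_suminf) auto
    finally show "ennreal (exp (- K * norm (t - s))) \<le> (\<Sum>k. ennreal (exp (- K * real k)) * indicator (ball t (real k + 1)) s)" .
  qed
  also have "\<dots> = (\<Sum>k. \<integral>\<^sup>+ s. ennreal (exp (- K * real k)) * indicator (ball t (real k + 1)) s \<partial>lborel)"
  proof (rule nn_integral_suminf)
    have [measurable]: "ball t r \<in> sets borel" for r by simp
    show "(\<lambda>s. ennreal (exp (- K * real k)) * indicator (ball t (real k + 1)) s) \<in> borel_measurable lborel" for k
      by measurable
  qed
  also have "\<dots> = (\<Sum>k. ennreal (a k))"
  proof (rule arg_cong[where f=suminf], rule ext)
    fix k
    have "(\<integral>\<^sup>+ s. ennreal (exp (- K * real k)) * indicator (ball t (real k + 1)) s \<partial>lborel)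
        = ennreal (exp (- K * real k)) * ennreal (V * (real k + 1) ^ m)"
      using emeasure_ball[of "real k + 1" t]
      by (subst nn_integral_cmult_indicator) (auto simp: V_def m_def)
    also have "\<dots> = ennreal (a k)"
      unfolding a_def by (rule ennreal_mult[symmetric]) (use \<open>0 \<le> V\<close> in auto)
    finally show "(\<integral>\<^sup>+ s. ennreal (exp (- K * real k)) * indicator (ball t (real k + 1)) s \<partial>lborel) = ennreal (a k)" .
  qed
  also have "\<dots> = ennreal (suminf a)"
    using \<open>summable a\<close> a_nonneg by (rule suminf_ennreal2[rotated])
  finally show "(\<integral>\<^sup>+ s. ennreal (exp (- K * norm (t - s))) \<partial>lborel) \<le> ennreal (suminf a)" by simp
qed

context levy_basis
begin

text \<open>
  If every \<open>X t\<close> is within \<open>\<epsilon>\<close> in mean of the integral of a simple function supported within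
  distance \<open>h / 2\<close> of \<open>t\<close>, then at index sets separated by \<open>h\<close> the approximating integrals are
  independent. Replacing the field by them costs at most \<open>2 * \<epsilon>\<close> times the normalising
  denominator, whatever the number of indices.
\<close>
lemma eta_coeff_le_simple_approx:
  fixes X :: "real ^ 'm \<Rightarrow> 'w \<Rightarrow> real ^ 'n"
  assumes X: "\<And>t. X t \<in> borel_measurable P"
    and "0 \<le> \<epsilon>"
    and approx: "\<And>t. \<exists>\<phi> :: real ^ 'm \<Rightarrow> real ^ 'd ^ 'n. levy_simple \<phi> \<and> (\<forall>s. \<phi> s \<noteq> 0 \<longrightarrow> infnorm (t - s) < h / 2) \<and>
      (\<integral>\<^sup>+ \<omega>. ennreal (norm (X t \<omega> - simple_levy_integral L \<phi> UNIV \<omega>)) \<partial>P) \<le> ennreal \<epsilon>"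
  shows "eta_coeff P X h \<le> ennreal (2 * \<epsilon>)"
proof -
  have "\<exists>\<phi>. \<forall>t. levy_simple (\<phi> t :: real ^ 'm \<Rightarrow> real ^ 'd ^ 'n) \<and> (\<forall>s. \<phi> t s \<noteq> 0 \<longrightarrow> infnorm (t - s) < h / 2) \<and>
      (\<integral>\<^sup>+ \<omega>. ennreal (norm (X t \<omega> - simple_levy_integral L (\<phi> t) UNIV \<omega>)) \<partial>P) \<le> ennreal \<epsilon>"
    by (intro choice allI approx)
  then obtain \<phi> :: "real ^ 'm \<Rightarrow> real ^ 'm \<Rightarrow> real ^ 'd ^ 'n" where simple: "\<And>t. levy_simple (\<phi> t)"
    and supp: "\<And>t s. \<phi> t s \<noteq> 0 \<Longrightarrow> infnorm (t - s) < h / 2"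
    and dist: "\<And>t. (\<integral>\<^sup>+ \<omega>. ennreal (norm (X t \<omega> - simple_levy_integral L (\<phi> t) UNIV \<omega>)) \<partial>P) \<le> ennreal \<epsilon>"
    by blast
  define S where "S t = simple_levy_integral L (\<phi> t) UNIV" for t
  have S: "S t \<in> borel_measurable P" for t
    unfolding S_def by (intro simple_levy_integral_measurable simple) simp
  note [measurable] = X S
  have int: "integrable P (\<lambda>\<omega>. norm (X t \<omega> - S t \<omega>))" for t
    using dist[of t] unfolding S_def[symmetric]
    by (intro integrableI_bounded) (auto intro: le_less_trans[OF _ ennreal_less_top])
  have dist': "expectation (\<lambda>\<omega>. norm (X t \<omega> - S t \<omega>)) \<le> \<epsilon>" for t
    using dist[of t] \<open>0 \<le> \<epsilon>\<close> unfolding S_def[symmetric] by (subst (asm) nn_integral_eq_integral[OF int]) auto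
  have sample_meas: "(\<lambda>\<omega>. F (sample Y k \<Gamma> \<omega>)) \<in> borel_measurable P"
    if "F \<in> test_functions k" "\<And>t. Y t \<in> borel_measurable P" for F k \<Gamma> and Y :: "real ^ 'm \<Rightarrow> 'w \<Rightarrow> real ^ 'n"
    unfolding sample_def by (intro test_function_sample_measurable that)
  have sample_tuple: "sample Y k \<Gamma> \<omega> \<in> tuples k" for k \<Gamma> \<omega> and Y :: "real ^ 'm \<Rightarrow> 'w \<Rightarrow> real ^ 'n"
    by (simp add: sample_def)
  have L1: "expectation (\<lambda>\<omega>. \<bar>F (sample X k \<Gamma> \<omega>) - F (sample S k \<Gamma> \<omega>)\<bar>) \<le> Lip k F * (real k * \<epsilon>)"
    if F: "F \<in> test_functions k" for F k \<Gamma>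
  proof -
    have "0 \<le> Lip k F" by (rule Lip_test_function(2)[OF F restrict_in_tuples restrict_in_tuples])
    have "expectation (\<lambda>\<omega>. \<bar>F (sample X k \<Gamma> \<omega>) - F (sample S k \<Gamma> \<omega>)\<bar>)
        \<le> expectation (\<lambda>\<omega>. Lip k F * (\<Sum>i<k. norm (X (\<Gamma> i) \<omega> - S (\<Gamma> i) \<omega>)))"
    proof (rule integral_mono)
      show le: "\<bar>F (sample X k \<Gamma> \<omega>) - F (sample S k \<Gamma> \<omega>)\<bar> \<le> Lip k F * (\<Sum>i<k. norm (X (\<Gamma> i) \<omega> - S (\<Gamma> i) \<omega>))" for \<omega>
        using Lip_test_function(1)[OF F sample_tuple sample_tuple, of X \<Gamma> \<omega> S \<Gamma> \<omega>] by (simp add: sample_def)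
      show int': "integrable P (\<lambda>\<omega>. Lip k F * (\<Sum>i<k. norm (X (\<Gamma> i) \<omega> - S (\<Gamma> i) \<omega>)))"
        using int by (intro integrable_mult_right Bochner_Integration.integrable_sum) auto
      have [measurable]: "(\<lambda>\<omega>. F (sample X k \<Gamma> \<omega>)) \<in> borel_measurable P" "(\<lambda>\<omega>. F (sample S k \<Gamma> \<omega>)) \<in> borel_measurable P"
        by (rule sample_meas[OF F X] sample_meas[OF F S])+
      show "integrable P (\<lambda>\<omega>. \<bar>F (sample X k \<Gamma> \<omega>) - F (sample S k \<Gamma> \<omega>)\<bar>)"
      proof (rule Bochner_Integration.integrable_bound[OF int'], measurable, rule AE_I2)
        show "norm \<bar>F (sample X k \<Gamma> \<omega>) - F (sample S k \<Gamma> \<omega>)\<bar>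
            \<le> norm (Lip k F * (\<Sum>i<k. norm (X (\<Gamma> i) \<omega> - S (\<Gamma> i) \<omega>)))" for \<omega>
          using le[of \<omega>] by simp
      qed
    qed
    also have "\<dots> = Lip k F * (\<Sum>i<k. expectation (\<lambda>\<omega>. norm (X (\<Gamma> i) \<omega> - S (\<Gamma> i) \<omega>)))"
      using int by (simp add: Bochner_Integration.integral_sum)
    also have "\<dots> \<le> Lip k F * (\<Sum>i<k. \<epsilon>)"
      by (intro mult_left_mono sum_mono dist' \<open>0 \<le> Lip k F\<close>)
    finally show ?thesis by simp
  qed
  have "\<bar>covariance P (\<lambda>\<omega>. F (sample X u \<Gamma> \<omega>)) (\<lambda>\<omega>. G (sample X v \<Delta> \<omega>))\<bar> / eta_denom u v F G \<le> 2 * \<epsilon>"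
    if F: "F \<in> test_functions u" and G: "G \<in> test_functions v" and denom: "eta_denom u v F G \<noteq> 0"
      and sep: "separated u \<Gamma> v \<Delta> h" for u v F G \<Gamma> \<Delta>
  proof -
    have nonneg: "0 \<le> sup_norm u F" "0 \<le> sup_norm v G" "0 \<le> Lip u F" "0 \<le> Lip v G"
      using order_trans[OF abs_ge_zero bounded_test_function[OF F restrict_in_tuples]]
        order_trans[OF abs_ge_zero bounded_test_function[OF G restrict_in_tuples]]
        Lip_test_function(2)[OF F restrict_in_tuples restrict_in_tuples]
        Lip_test_function(2)[OF G restrict_in_tuples restrict_in_tuples] by auto
    then have "0 \<le> eta_denom u v F G" by (simp add: eta_denom_def)
    with denom have pos: "0 < eta_denom u v F G" by simp
    have "covariance P (\<lambda>\<omega>. F (sample S u \<Gamma> \<omega>)) (\<lambda>\<omega>. G (sample S v \<Delta> \<omega>)) = 0"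
      unfolding sample_def S_def
    proof (rule covariance_disjoint_supports[OF simple simple _ F G])
      show "\<phi> (\<Gamma> i) s = 0 \<or> \<phi> (\<Delta> j) s = 0" if "i < u" "j < v" for i j s
      proof (rule ccontr)
        assume "\<not> (\<phi> (\<Gamma> i) s = 0 \<or> \<phi> (\<Delta> j) s = 0)"
        then have "infnorm (\<Gamma> i - s) < h / 2" "infnorm (\<Delta> j - s) < h / 2" using supp by blast+
        moreover have "infnorm (\<Gamma> i - \<Delta> j) \<le> infnorm (\<Gamma> i - s) + infnorm (\<Delta> j - s)"
          using infnorm_triangle[of "\<Gamma> i - s" "s - \<Delta> j"] infnorm_sub[of s "\<Delta> j"] by simp
        moreover have "h \<le> infnorm (\<Gamma> i - \<Delta> j)" using sep that by (simp add: separated_def)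
        ultimately show False by simp
      qed
    qed
    then have "\<bar>covariance P (\<lambda>\<omega>. F (sample X u \<Gamma> \<omega>)) (\<lambda>\<omega>. G (sample X v \<Delta> \<omega>))\<bar>
        \<le> 2 * sup_norm v G * expectation (\<lambda>\<omega>. \<bar>F (sample X u \<Gamma> \<omega>) - F (sample S u \<Gamma> \<omega>)\<bar>)
        + 2 * sup_norm u F * expectation (\<lambda>\<omega>. \<bar>G (sample X v \<Delta> \<omega>) - G (sample S v \<Delta> \<omega>)\<bar>)"
      using covariance_perturbation[of "\<lambda>\<omega>. F (sample X u \<Gamma> \<omega>)" "\<lambda>\<omega>. G (sample X v \<Delta> \<omega>)"
          "\<lambda>\<omega>. F (sample S u \<Gamma> \<omega>)" "\<lambda>\<omega>. G (sample S v \<Delta> \<omega>)" "sup_norm u F" "sup_norm v G"]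
        sample_meas[OF F X] sample_meas[OF G X] sample_meas[OF F S] sample_meas[OF G S]
        bounded_test_function[OF F sample_tuple] bounded_test_function[OF G sample_tuple]
      by simp
    also have "\<dots> \<le> 2 * sup_norm v G * (Lip u F * (real u * \<epsilon>)) + 2 * sup_norm u F * (Lip v G * (real v * \<epsilon>))"
      using nonneg by (intro add_mono mult_left_mono L1 F G) auto
    also have "\<dots> = 2 * \<epsilon> * eta_denom u v F G" by (simp add: eta_denom_def algebra_simps)
    finally show ?thesis using pos by (simp add: divide_le_eq)
  qed
  then show ?thesis
    unfolding eta_coeff_def eta_uv_def
    by (intro SUP_least) (auto intro!: ennreal_leI)
qed

end

lemma levy_simple_indicator_scaleR:
  fixes f :: "real ^ 'm \<Rightarrow> real ^ 'd ^ 'n"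
  assumes f: "levy_simple f" and B: "B \<in> sets borel"
  shows "levy_simple (\<lambda>s. (indicator B s :: real) *\<^sub>R f s)"
  unfolding levy_simple_def
proof
  have "simple_function borel (indicator B :: real ^ 'm \<Rightarrow> real)"
    by (rule simple_function_indicator) (use B in simp)
  then show "simple_function borel (\<lambda>s. (indicator B s :: real) *\<^sub>R f s)"
    by (rule simple_function_compose2) (use f in \<open>simp add: levy_simple_def\<close>)
  show "bounded {s. (indicator B s :: real) *\<^sub>R f s \<noteq> 0}"
    by (rule bounded_subset[of "{s. f s \<noteq> 0}"]) (use f in \<open>auto simp: levy_simple_def\<close>)
qed

context l2_levy_basis
begin

text \<open>
  The simple approximation is cut off outside \<open>B\<close>; the squared error is at most the squared approximation
  error plus the tail of \<open>f\<close> outside. The passage from second to first moments is the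
  inequality of arithmetic and geometric means with weight \<open>\<delta>\<close>.
\<close>
lemma truncated_simple_approx:
  fixes f :: "real ^ 'm \<Rightarrow> real ^ 'd ^ 'n"
  assumes f: "f \<in> borel_measurable borel" "(\<integral>\<^sup>+ s. ennreal ((norm (f s))\<^sup>2) \<partial>lborel) < \<infinity>"
    and X: "has_levy_integral P L f UNIV X"
    and B [measurable]: "B \<in> sets borel"
    and \<delta>: "0 < \<delta>" and "0 \<le> a"
    and tail: "(\<integral>\<^sup>+ s\<in>- B. ennreal ((norm (f s))\<^sup>2) \<partial>lborel) \<le> ennreal (a * \<delta>\<^sup>2)"
  shows "\<exists>\<phi> :: real ^ 'm \<Rightarrow> real ^ 'd ^ 'n. levy_simple \<phi> \<and> (\<forall>s. \<phi> s \<noteq> 0 \<longrightarrow> s \<in> B) \<and>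
    (\<integral>\<^sup>+ \<omega>. ennreal (norm (X \<omega> - simple_levy_integral L \<phi> UNIV \<omega>)) \<partial>P) \<le> ennreal ((1 / 2 + c * (1 + a)) * \<delta>)"
proof -
  note [measurable] = f(1)
  obtain G where G: "\<And>k. levy_simple (G k)" "\<And>s. (\<lambda>k. G k s) \<longlonglongrightarrow> f s"
    "\<And>k. (\<integral>\<^sup>+ s. ennreal ((norm (G k s - f s))\<^sup>2) \<partial>lborel) \<le> ennreal ((1 / 4) ^ k)"
    using L2_approx_levy_simple[OF f] by blast
  obtain k where k: "(1 / 4) ^ k < \<delta>\<^sup>2"
    using real_arch_pow_inv[of "\<delta>\<^sup>2" "1 / 4"] \<delta> by auto
  have [measurable]: "G k \<in> borel_measurable borel" using G(1) by (rule levy_simple_measurable)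
  define \<phi> where "\<phi> s = (indicator B s :: real) *\<^sub>R G k s" for s
  have simple: "levy_simple \<phi>"
    unfolding \<phi>_def by (rule levy_simple_indicator_scaleR[OF G(1) B])
  define V where "V \<omega> = X \<omega> - simple_levy_integral L \<phi> UNIV \<omega>" for \<omega>
  have [measurable]: "V \<in> borel_measurable P"
  proof -
    have "X \<in> borel_measurable P" using X by (auto simp: has_levy_integral_def tendsto_in_prob_def)
    moreover have "simple_levy_integral L \<phi> UNIV \<in> borel_measurable P"
      by (rule simple_levy_integral_measurable[OF simple]) simp
    ultimately show ?thesis unfolding V_def by measurable
  qed
  have "(\<integral>\<^sup>+ s. ennreal ((norm (f s - \<phi> s))\<^sup>2) \<partial>lborel)
      \<le> (\<integral>\<^sup>+ s. ennreal ((norm (G k s - f s))\<^sup>2) + ennreal ((norm (f s))\<^sup>2) * indicator (- B) s \<partial>lborel)"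
    by (intro nn_integral_mono) (auto simp: \<phi>_def indicator_def norm_minus_commute)
  also have "\<dots> = (\<integral>\<^sup>+ s. ennreal ((norm (G k s - f s))\<^sup>2) \<partial>lborel) + (\<integral>\<^sup>+ s\<in>- B. ennreal ((norm (f s))\<^sup>2) \<partial>lborel)"
    by (intro nn_integral_add) measurable
  also have "\<dots> \<le> ennreal (\<delta>\<^sup>2) + ennreal (a * \<delta>\<^sup>2)"
    by (intro add_mono tail order_trans[OF G(3)] ennreal_leI less_imp_le k)
  also have "\<dots> = ennreal ((1 + a) * \<delta>\<^sup>2)"
    using \<open>0 \<le> a\<close> by (subst ennreal_plus[symmetric]) (auto simp: distrib_right)
  finally have "ennreal (2 * c) * (\<integral>\<^sup>+ s. ennreal ((norm (f s - \<phi> s))\<^sup>2) \<partial>lborel) \<le> ennreal (2 * c) * ennreal ((1 + a) * \<delta>\<^sup>2)"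
    by (rule mult_left_mono) simp
  also have "\<dots> = ennreal (2 * c * ((1 + a) * \<delta>\<^sup>2))"
    using c_pos \<open>0 \<le> a\<close> by (intro ennreal_mult[symmetric]) auto
  finally have V2: "(\<integral>\<^sup>+ \<omega>. ennreal ((norm (V \<omega>))\<^sup>2) \<partial>P) \<le> ennreal (2 * c * ((1 + a) * \<delta>\<^sup>2))"
    using order_trans[OF has_levy_integral_L2_dist[OF f X simple]] unfolding V_def by blast
  have "(\<integral>\<^sup>+ \<omega>. ennreal (norm (V \<omega>)) \<partial>P)
      \<le> (\<integral>\<^sup>+ \<omega>. ennreal (\<delta> / 2) + ennreal (1 / (2 * \<delta>)) * ennreal ((norm (V \<omega>))\<^sup>2) \<partial>P)"
  proof (rule nn_integral_mono)
    fix \<omega>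
    have "0 \<le> (\<delta> - norm (V \<omega>))\<^sup>2 / (2 * \<delta>)" using \<delta> by simp
    also have "\<dots> = \<delta> / 2 + 1 / (2 * \<delta>) * (norm (V \<omega>))\<^sup>2 - norm (V \<omega>)"
      using \<delta> by (simp add: power2_diff field_simps power2_eq_square)
    finally have "norm (V \<omega>) \<le> \<delta> / 2 + 1 / (2 * \<delta>) * (norm (V \<omega>))\<^sup>2" by simp
    then show "ennreal (norm (V \<omega>)) \<le> ennreal (\<delta> / 2) + ennreal (1 / (2 * \<delta>)) * ennreal ((norm (V \<omega>))\<^sup>2)"
      using \<delta> by (simp add: ennreal_leI ennreal_mult''[symmetric] ennreal_plus[symmetric] del: ennreal_plus)
  qed
  also have "\<dots> = ennreal (\<delta> / 2) + ennreal (1 / (2 * \<delta>)) * (\<integral>\<^sup>+ \<omega>. ennreal ((norm (V \<omega>))\<^sup>2) \<partial>P)"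
    by (subst nn_integral_add) (auto simp: nn_integral_cmult emeasure_space_1)
  also have "\<dots> \<le> ennreal (\<delta> / 2) + ennreal (1 / (2 * \<delta>)) * ennreal (2 * c * ((1 + a) * \<delta>\<^sup>2))"
    by (intro add_left_mono mult_left_mono V2) simp
  also have "\<dots> = ennreal (\<delta> / 2 + 1 / (2 * \<delta>) * (2 * c * ((1 + a) * \<delta>\<^sup>2)))"
    using c_pos \<delta> \<open>0 \<le> a\<close> by (simp add: ennreal_mult[symmetric] ennreal_plus[symmetric] del: ennreal_plus)
  also have "\<delta> / 2 + 1 / (2 * \<delta>) * (2 * c * ((1 + a) * \<delta>\<^sup>2)) = (1 / 2 + c * (1 + a)) * \<delta>"
    using \<delta> by (simp add: field_simps power2_eq_square)
  finally have "(\<integral>\<^sup>+ \<omega>. ennreal (norm (V \<omega>)) \<partial>P) \<le> ennreal ((1 / 2 + c * (1 + a)) * \<delta>)" .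
  with simple show ?thesis
    unfolding V_def by (intro exI[of _ \<phi>]) (auto simp: \<phi>_def indicator_def split: if_splits)
qed

end

theorem theorem3p36:
  fixes P :: "'w measure"
    and L :: "(real ^ 'm) set \<Rightarrow> 'w \<Rightarrow> real ^ 'd"
    and \<gamma> :: "real ^ 'd"
    and \<Sigma> :: "real ^ 'd ^ 'd"
    and \<nu> :: "(real ^ 'd) measure"
    and g :: "real ^ 'm \<Rightarrow> real ^ 'd ^ 'n"
  assumes "levy_basis P L \<gamma> \<Sigma> \<nu>"
    and "(\<integral>\<^sup>+ x \<in> {x. norm x > 1}. ennreal ((norm x)\<^sup>2) \<partial>\<nu>) < \<infinity>"
    and "\<gamma> + (LINT x : {x. norm x > 1} | \<nu>. x) = 0"
    and "g \<in> borel_measurable borel"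
    and "\<exists>M>0. \<exists>K>0. \<forall>t. (norm (g t))\<^sup>2 \<le> M * exp (- K * norm t)"
  shows "(\<forall>t. levy_integrable P L (\<lambda>s. g (t - s))) \<and>
    (\<forall>X. (\<forall>t. has_levy_integral P L (\<lambda>s. g (t - s)) UNIV (X t)) \<longrightarrow>
      eta_weakly_dependent P X \<and>
      (\<exists>C>0. \<exists>\<kappa>>0. \<forall>h>0. eta_coeff P X h \<le> ennreal (C * exp (- \<kappa> * h))))"
proof -
  obtain c where "c > 0" and c: "\<And>B u. bounded_borel B \<Longrightarrow>
    (\<integral>\<^sup>+ \<omega>. ennreal ((u \<bullet> L B \<omega>)\<^sup>2) \<partial>P) \<le> ennreal (c * (norm u)\<^sup>2 * measure lborel B) \<and>
    (LINT \<omega>|P. u \<bullet> L B \<omega>) = 0"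
    using levy_basis_moments[OF assms(1-3)] by blast
  interpret levy_basis P L \<gamma> \<Sigma> \<nu> by fact
  interpret l2_levy_basis P L \<gamma> \<Sigma> \<nu> c
    by unfold_locales (use \<open>c > 0\<close> c in auto)
  obtain M K where "M > 0" "K > 0" and g: "\<And>t. (norm (g t))\<^sup>2 \<le> M * exp (- K * norm t)"
    using assms(5) by blast
  note [measurable] = assms(4)
  have K2: "0 < K / 2" using \<open>K > 0\<close> by simp
  obtain C0 where "0 \<le> C0" and C0: "\<And>t :: real ^ 'm.
    (\<integral>\<^sup>+ s. ennreal (exp (- (K / 2) * norm (t - s))) \<partial>lborel) \<le> ennreal C0"
    using nn_integral_exp_norm_bounded[OF K2] by blast
  have meas: "(\<lambda>s. g (t - s)) \<in> borel_measurable borel" for t by measurable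
  \<comment> \<open>Half of the exponential decay of \<open>g\<close> provides the decay in the radius, the other half integrability.\<close>
  have tail: "(\<integral>\<^sup>+ s\<in>- {s. infnorm (t - s) < r}. ennreal ((norm (g (t - s)))\<^sup>2) \<partial>lborel)
      \<le> ennreal (M * C0 * exp (- (K / 2) * r))" for t r
  proof -
    have "(\<integral>\<^sup>+ s\<in>- {s. infnorm (t - s) < r}. ennreal ((norm (g (t - s)))\<^sup>2) \<partial>lborel)
        \<le> (\<integral>\<^sup>+ s. ennreal (M * exp (- (K / 2) * r)) * ennreal (exp (- (K / 2) * norm (t - s))) \<partial>lborel)"
    proof (rule nn_integral_mono)
      fix s
      have "(norm (g (t - s)))\<^sup>2 \<le> M * exp (- (K / 2) * r) * exp (- (K / 2) * norm (t - s))"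
        if "r \<le> infnorm (t - s)"
      proof -
        have "r \<le> norm (t - s)" using that infnorm_le_norm[of "t - s"] by simp
        then have "- K * norm (t - s) \<le> - (K / 2) * r + - (K / 2) * norm (t - s)"
          using \<open>K > 0\<close> by (simp add: field_simps)
        then have "exp (- K * norm (t - s)) \<le> exp (- (K / 2) * r) * exp (- (K / 2) * norm (t - s))"
          unfolding exp_add[symmetric] by simp
        then have "M * exp (- K * norm (t - s)) \<le> M * (exp (- (K / 2) * r) * exp (- (K / 2) * norm (t - s)))"
          using \<open>M > 0\<close> by (intro mult_left_mono) auto
        with g[of "t - s"] show ?thesis by (simp add: mult.assoc)
      qed
      then show "ennreal ((norm (g (t - s)))\<^sup>2) * indicator (- {s. infnorm (t - s) < r}) s
          \<le> ennreal (M * exp (- (K / 2) * r)) * ennreal (exp (- (K / 2) * norm (t - s)))"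
        using \<open>M > 0\<close> by (auto simp: indicator_def not_less ennreal_mult[symmetric] intro!: ennreal_leI)
    qed
    also have "\<dots> = ennreal (M * exp (- (K / 2) * r)) * (\<integral>\<^sup>+ s. ennreal (exp (- (K / 2) * norm (t - s))) \<partial>lborel)"
      by (rule nn_integral_cmult) measurable
    also have "\<dots> \<le> ennreal (M * exp (- (K / 2) * r)) * ennreal C0"
      by (intro mult_left_mono C0) simp
    also have "\<dots> = ennreal (M * C0 * exp (- (K / 2) * r))"
      using \<open>M > 0\<close> \<open>0 \<le> C0\<close> by (simp add: ennreal_mult[symmetric] mult_ac)
    finally show ?thesis .
  qed
  have L2: "(\<integral>\<^sup>+ s. ennreal ((norm (g (t - s)))\<^sup>2) \<partial>lborel) < \<infinity>" for t
    using le_less_trans[OF tail[of t 0] ennreal_less_top] by (simp add: not_less infnorm_pos_le)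
  have box: "{s. infnorm (t - s) < r} \<in> sets borel" for t :: "real ^ 'm" and r
    by (intro borel_open open_Collect_less continuous_intros)
  have decay: "\<exists>C>0. \<exists>\<kappa>>0. \<forall>h>0. eta_coeff P X h \<le> ennreal (C * exp (- \<kappa> * h))"
    if X: "\<And>t. has_levy_integral P L (\<lambda>s. g (t - s)) UNIV (X t)" for X
  proof -
    have X_meas: "X t \<in> borel_measurable P" for t
      using X[of t] by (auto simp: has_levy_integral_def tendsto_in_prob_def)
    define a where "a = M * C0"
    have "0 \<le> a" using \<open>M > 0\<close> \<open>0 \<le> C0\<close> by (simp add: a_def)
    define D where "D = 1 / 2 + c * (1 + a)"
    have "D > 0" using c_pos \<open>0 \<le> a\<close> by (simp add: D_def add_pos_nonneg)
    have "eta_coeff P X h \<le> ennreal (2 * D * exp (- (K / 8) * h))" if "h > 0" for h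
    proof -
      \<comment> \<open>At the truncation radius \<open>h / 2\<close> the squared \<open>L\<^sup>2\<close> error is of order \<open>exp (- K * h / 4)\<close>; its root
        has the rate \<open>K / 8\<close>.\<close>
      define \<delta> where "\<delta> = exp (- (K / 8) * h)"
      have "\<delta> > 0" by (simp add: \<delta>_def)
      have \<delta>2: "a * \<delta>\<^sup>2 = M * C0 * exp (- (K / 2) * (h / 2))"
        by (simp add: \<delta>_def a_def exp_of_nat_mult[symmetric])
      have "eta_coeff P X h \<le> ennreal (2 * (D * \<delta>))"
      proof (rule eta_coeff_le_simple_approx[OF X_meas])
        show "0 \<le> D * \<delta>" using \<open>D > 0\<close> \<open>\<delta> > 0\<close> by simp
        show "\<exists>\<phi> :: real ^ 'm \<Rightarrow> real ^ 'd ^ 'n. levy_simple \<phi> \<and> (\<forall>s. \<phi> s \<noteq> 0 \<longrightarrow> infnorm (t - s) < h / 2) \<and>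
            (\<integral>\<^sup>+ \<omega>. ennreal (norm (X t \<omega> - simple_levy_integral L \<phi> UNIV \<omega>)) \<partial>P) \<le> ennreal (D * \<delta>)" for t
          using truncated_simple_approx[OF meas L2 X box \<open>\<delta> > 0\<close> \<open>0 \<le> a\<close>, of t t "h / 2"] tail[of t "h / 2"]
          unfolding \<delta>2 D_def by auto
      qed
      then show ?thesis by (simp add: \<delta>_def mult.assoc)
    qed
    moreover have "2 * D > 0" "K / 8 > 0" using \<open>D > 0\<close> \<open>K > 0\<close> by auto
    ultimately show ?thesis by blast
  qed
  have weak: "eta_weakly_dependent P X" if "C > 0" "\<kappa> > 0"
    and bound: "\<forall>h>0. eta_coeff P X h \<le> ennreal (C * exp (- \<kappa> * h))"
    for C \<kappa> and X :: "real ^ 'm \<Rightarrow> 'w \<Rightarrow> real ^ 'n"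
    unfolding eta_weakly_dependent_def
  proof (rule tendsto_sandwich[where f="\<lambda>_. 0"])
    have "((\<lambda>h. C * exp (- \<kappa> * h)) \<longlongrightarrow> 0) at_top" using \<open>\<kappa> > 0\<close> by real_asymp
    then show "((\<lambda>h. ennreal (C * exp (- \<kappa> * h))) \<longlongrightarrow> 0) at_top" using tendsto_ennrealI by fastforce
    show "\<forall>\<^sub>F h in at_top. eta_coeff P X h \<le> ennreal (C * exp (- \<kappa> * h))"
      using eventually_gt_at_top[of 0] by eventually_elim (use bound in auto)
  qed (rule always_eventually, auto)
  show ?thesis
  proof (intro conjI allI impI)
    show "levy_integrable P L (\<lambda>s. g (t - s))" for t
      by (rule levy_integrable_L2[OF meas L2])
    fix X assume "\<forall>t. has_levy_integral P L (\<lambda>s. g (t - s)) UNIV (X t)"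
    then show *: "\<exists>C>0. \<exists>\<kappa>>0. \<forall>h>0. eta_coeff P X h \<le> ennreal (C * exp (- \<kappa> * h))"
      using decay by blast
    then show "eta_weakly_dependent P X" using weak by blast
  qed
qed

end
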